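(* Let $n\ge2$ and let $W=S_n$ act on $\mathbf V_n$ through the $\check R$-matrix, i.e. with $\boldsymbol s_i=\check R_{n-i,n-i+1}(\alpha_i)\circ(s_i\otimes1)$, $1\le i\le n-1$, as in the context. (i) Explicitly, for $\chi\in\mathrm{Rep}_{\mathbb T}$ and a $01$-word $J=j_1\cdots j_n$, $$\boldsymbol s_i(\chi\otimes v_J)=\begin{cases}\alpha_i\,\chi^{s_i}\otimes v_J+(1-\alpha_i)\,\chi^{s_i}\otimes v_{s_i.J},&j_i>j_{i+1},\\ \chi^{s_i}\otimes v_J,&\text{otherwise},\end{cases}$$ where $\alpha_i=\varepsilon_i/\varepsilon_{i+1}$, $\chi^{s_i}$ is $\chi$ with $\varepsilon_i,\varepsilon_{i+1}$ exchanged, and $s_i.J$ is $J$ with the letters $j_i,j_{i+1}$ exchanged. (ii) For every $0\le k\le n$ the subspace $V_{k,n}\subset\mathbf V_n$ spanned by all $v_J$ with $J$ having exactly $k$ zero-letters is invariant under this action. (iii) The $W$-action commutes with all operators $t_{ij}(z)$ and all operators $\tilde t_{ij}(z)$, $i,j\in\{0,1\}$, on $\mathbf V_n$ (with $W$ acting trivially on $z$).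
   Context: $\mathrm{Rep}_{\mathbb T}=\mathbb Z[\varepsilon_1^{\pm1},\dots,\varepsilon_n^{\pm1}]$ with $S_n$ permuting the $\varepsilon_i$. $v_0,v_1$ is a basis of a rank-2 free module, $E_{ab}$ the matrix unit with $E_{ab}v_b=v_a$. $\mathbf V_n$ is the free $\mathrm{Rep}_{\mathbb T}$-module with basis $v_{a_1}\otimes\cdots\otimes v_{a_n}$, $a_i\in\{0,1\}$, written $\mathrm{Rep}_{\mathbb T}\otimes(\mathbb C^2)^{\otimes n}$. For a word $J=j_1\cdots j_n$, $v_J:=v_{j_n}\otimes\cdots\otimes v_{j_1}$. $R$-matrix: $R(z)(v_0\otimes v_0)=v_0\otimes v_0$, $R(z)(v_1\otimes v_1)=v_1\otimes v_1$, $R(z)(v_0\otimes v_1)=(1-z)v_0\otimes v_1+z\,v_1\otimes v_0$, $R(z)(v_1\otimes v_0)=v_0\otimes v_1$. $\check R(z)=P\circ R(z)$ with $P$ the flip. $\check R_{n-i,n-i+1}$ acts in tensor factors number $n-i,n-i+1$ (counted from the left). $s_i\otimes 1$ is the action of $s_i$ on $\mathrm{Rep}_{\mathbb T}$-coefficients. The operators $\boldsymbol s_i$ satisfy the Coxeter relations of $S_n$ and hence define an action of $S_n$ on $\mathbf V_n$. Operators: $t^{\varepsilon}_{00}(z)=E_{00}+(1+z/\varepsilon)E_{11}$, $t^{\varepsilon}_{01}(z)=E_{10}$, $t^{\varepsilon}_{10}(z)=-(z/\varepsilon)E_{01}$, $t^{\varepsilon}_{11}(z)=E_{11}$; $\tilde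 t^{\varepsilon}_{00}(z)=(1+z\varepsilon)E_{00}+E_{11}$, $\tilde t^{\varepsilon}_{01}(z)=-z\varepsilon E_{10}$, $\tilde t^{\varepsilon}_{10}(z)=E_{01}$, $\tilde t^{\varepsilon}_{11}(z)=E_{00}$. The $\mathrm{Rep}_{\mathbb T}$-linear operators on $\mathbf V_n$ are $t_{ij}(z)=\sum_{k_1,\dots,k_{n-1}\in\{0,1\}}t^{\varepsilon_n}_{k_1j}(z)\otimes t^{\varepsilon_{n-1}}_{k_2k_1}(z)\otimes\cdots\otimes t^{\varepsilon_1}_{i\,k_{n-1}}(z)$ and likewise $\tilde t_{ij}(z)$ with $t^{\varepsilon}$ replaced by $\tilde t^{\varepsilon}$. (These are the images of the generators of the Yang–Baxter algebra and of the opposite Yang–Baxter algebra.) *)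

theory Defs
  imports
    "HOL-Library.Poly_Mapping"
    "HOL-Computational_Algebra.Polynomial"
    "HOL-Algebra.Group_Action"
    "HOL-Algebra.Sym_Groups"
begin

section \<open>The Laurent polynomial ring\<close>

text \<open>
  Laurent polynomials are elements of the monoid ring over the integers of the additive group
  of finitely supported exponent vectors; the ring in \<open>n\<close> variables is the subring of those whose
  exponent vectors are supported in \<open>{1..n}\<close>.
\<close>

type_synonym laurent = "(nat \<Rightarrow>\<^sub>0 int) \<Rightarrow>\<^sub>0 int"

definition Rep_T :: "nat \<Rightarrow> laurent set" where
  "Rep_T n = {\<chi>. \<forall>m \<in> Poly_Mapping.keys \<chi>. Poly_Mapping.keys m \<subseteq> {1..n}}"

definition eps :: "nat \<Rightarrow> laurent" where
  "eps i = Poly_Mapping.single (Poly_Mapping.single i 1) 1"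

definition eps_inv :: "nat \<Rightarrow> laurent" where
  "eps_inv i = Poly_Mapping.single (Poly_Mapping.single i (-1)) 1"

lemma eps_eps_inv: "eps i * eps_inv i = 1"
proof -
  have "Poly_Mapping.single i (1::int) + Poly_Mapping.single i (-1) = 0"
    by (simp flip: single_add)
  then show ?thesis
    by (simp add: eps_def eps_inv_def mult_single)
qed

definition \<alpha> :: "nat \<Rightarrow> laurent" where
  "\<alpha> i = eps i * eps_inv (Suc i)"

text \<open>
  For a permutation \<open>\<sigma>\<close>, the coefficient at \<open>m\<close> of the following is the coefficient of \<open>\<chi>\<close> at
  \<open>m \<circ> \<sigma>\<close>, so that the variable with index \<open>i\<close> is sent to the one with index \<open>\<sigma> i\<close>.
\<close>

definition perm_laurent :: "(nat \<Rightarrow> nat) \<Rightarrow> laurent \<Rightarrow> laurent" where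
  "perm_laurent \<sigma> \<chi> = Poly_Mapping.map_key (Poly_Mapping.map_key \<sigma>) \<chi>"

lemma perm_laurent_monomial:
  assumes "bij \<sigma>"
  shows "perm_laurent \<sigma> (Poly_Mapping.single m c)
           = Poly_Mapping.single (Poly_Mapping.map_key (inv' \<sigma>) m) c"
proof -
  have s: "inj \<sigma>" "inj (inv' \<sigma>)"
    using assms by (auto simp: bij_is_inj bij_imp_bij_inv)
  have r: "Poly_Mapping.map_key \<sigma> (Poly_Mapping.map_key (inv' \<sigma>) k) = k" for k :: "nat \<Rightarrow>\<^sub>0 int"
    using s by (intro poly_mapping_eqI) (simp add: map_key.rep_eq)
  have l: "Poly_Mapping.map_key (inv' \<sigma>) (Poly_Mapping.map_key \<sigma> k) = k" for k :: "nat \<Rightarrow>\<^sub>0 int"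
    using s assms by (intro poly_mapping_eqI) (simp add: map_key.rep_eq bij_is_surj surj_f_inv_f)
  have "inj (Poly_Mapping.map_key \<sigma> :: (nat \<Rightarrow>\<^sub>0 int) \<Rightarrow> _)"
    by (metis l injI)
  then show ?thesis
    unfolding perm_laurent_def using map_key_single[of "Poly_Mapping.map_key \<sigma>"] r by metis
qed

lemma perm_laurent_eps:
  assumes "bij \<sigma>"
  shows "perm_laurent \<sigma> (eps i) = eps (\<sigma> i)"
proof -
  have "Poly_Mapping.map_key (inv' \<sigma>) (Poly_Mapping.single i (1::int)) = Poly_Mapping.single (\<sigma> i) 1"
    using assms map_key_single[of "inv' \<sigma>" "\<sigma> i" "1::int"]
    by (simp add: bij_imp_bij_inv bij_is_inj)
  then show ?thesis
    by (simp add: eps_def perm_laurent_monomial[OF assms])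
qed


section \<open>The tensor power\<close>

text \<open>
  The list \<open>[a\<^sub>1, \<dots>, a\<^sub>n]\<close> indexes the basis vector \<open>v a\<^sub>1 \<otimes> \<dots> \<otimes> v a\<^sub>n\<close>; a vector is its
  coefficient function. The definitions are polymorphic in the coefficients because they are used
  both over Laurent polynomials and over polynomials in \<open>z\<close> with Laurent coefficients.
\<close>

type_synonym 'a vec = "nat list \<Rightarrow> 'a"

definition words :: "nat \<Rightarrow> nat list set" where
  "words n = {a. length a = n \<and> set a \<subseteq> {0, 1}}"

definition basis :: "nat list \<Rightarrow> 'a::comm_ring_1 vec" where
  "basis a = (\<lambda>b. if b = a then 1 else 0)"

text \<open>The linear operator on the \<open>n\<close>-th tensor power that sends \<open>basis a\<close> to \<open>B a\<close>.\<close>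

definition lin :: "nat \<Rightarrow> (nat list \<Rightarrow> 'a vec) \<Rightarrow> 'a::comm_ring_1 vec \<Rightarrow> 'a vec" where
  "lin n B f = (\<lambda>b. \<Sum>a\<in>words n. f a * B a b)"

definition V :: "nat \<Rightarrow> laurent vec set" where
  "V n = {f. (\<forall>a. f a \<in> Rep_T n) \<and> (\<forall>a. a \<notin> words n \<longrightarrow> f a = 0)}"

text \<open>\<open>pure \<chi> J\<close> is \<open>\<chi> \<otimes> v\<^sub>J\<close>. The tensor factors of \<open>v\<^sub>J\<close> are the letters of \<open>J\<close> in reverse.\<close>

definition pure :: "laurent \<Rightarrow> nat list \<Rightarrow> laurent vec" where
  "pure \<chi> J = (\<lambda>a. \<chi> * basis (rev J) a)"

definition Vk :: "nat \<Rightarrow> nat \<Rightarrow> laurent vec set" where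
  "Vk k n = {f. \<exists>c. (\<forall>J. c J \<in> Rep_T n) \<and>
                    f = (\<lambda>a. \<Sum>J | J \<in> words n \<and> count_list J 0 = k. pure (c J) J a)}"


section \<open>The action through the R-matrix\<close>

text \<open>\<open>R\<close> and \<open>flip\<close> are operators on the second tensor power.\<close>

definition R :: "'a::comm_ring_1 \<Rightarrow> 'a vec \<Rightarrow> 'a vec" where
  "R z = lin 2 (\<lambda>a. if a = [0, 1] then (\<lambda>b. (1 - z) * basis [0, 1] b + z * basis [1, 0] b)
                    else if a = [1, 0] then basis [0, 1]
                    else basis a)"

definition flip :: "'a::comm_ring_1 vec \<Rightarrow> 'a vec" where
  "flip = lin 2 (\<lambda>a. basis (rev a))"

definition R_check :: "'a::comm_ring_1 \<Rightarrow> 'a vec \<Rightarrow> 'a vec" where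
  "R_check z = flip \<circ> R z"

text \<open>
  \<open>R_check\<close> acting in the tensor factors number \<open>p\<close> and \<open>p + 1\<close>, counted from 1; these are
  the list positions \<open>p - 1\<close> and \<open>p\<close>.
\<close>

definition R_check_at :: "nat \<Rightarrow> nat \<Rightarrow> 'a::comm_ring_1 \<Rightarrow> 'a vec \<Rightarrow> 'a vec" where
  "R_check_at n p z = lin n (\<lambda>a b.
     if b \<in> words n \<and> take (p - 1) b = take (p - 1) a \<and> drop (p + 1) b = drop (p + 1) a
     then R_check z (basis [a ! (p - 1), a ! p]) [b ! (p - 1), b ! p]
     else 0)"

definition bold_s :: "nat \<Rightarrow> nat \<Rightarrow> laurent vec \<Rightarrow> laurent vec" where
  "bold_s n i f =
     R_check_at n (n - i) (\<alpha> i) (\<lambda>a. perm_laurent (Transposition.transpose i (Suc i)) (f a))"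

text \<open>
  Group actions in HOL-Algebra are by bijections that are extensional on the underlying set,
  hence the restriction.
\<close>

definition R_action :: "nat \<Rightarrow> ((nat \<Rightarrow> nat) \<Rightarrow> laurent vec \<Rightarrow> laurent vec) \<Rightarrow> bool" where
  "R_action n \<rho> \<longleftrightarrow>
     group_action (sym_group n) (V n) \<rho> \<and>
     (\<forall>i \<in> {1..<n}. \<rho> (Transposition.transpose i (Suc i)) = restrict (bold_s n i) (V n))"


section \<open>The operators depending on the spectral parameter\<close>

type_synonym 'a mat2 = "nat \<Rightarrow> nat \<Rightarrow> 'a"

definition E :: "nat \<Rightarrow> nat \<Rightarrow> 'a::comm_ring_1 mat2" where
  "E a b = (\<lambda>r c. if r = a \<and> c = b then 1 else 0)"

text \<open>
  \<open>M q\<close> is the matrix acting in the tensor factor at list position \<open>q\<close>.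
\<close>

definition tensor_op :: "nat \<Rightarrow> (nat \<Rightarrow> 'a mat2) \<Rightarrow> 'a::comm_ring_1 vec \<Rightarrow> 'a vec" where
  "tensor_op n M = lin n (\<lambda>a b. if b \<in> words n then \<Prod>q<n. M q (b ! q) (a ! q) else 0)"

text \<open>
  The first argument of the local operators is the index of the variable occurring in them.
  The polynomial \<open>[:0, \<chi>:]\<close> is \<open>z \<chi>\<close>.
\<close>

definition t_loc :: "nat \<Rightarrow> nat \<Rightarrow> nat \<Rightarrow> laurent poly mat2" where
  "t_loc m i j =
     (if (i, j) = (0, 0) then (\<lambda>r c. E 0 0 r c + (1 + [:0, eps_inv m:]) * E 1 1 r c)
      else if (i, j) = (0, 1) then E 1 0
      else if (i, j) = (1, 0) then (\<lambda>r c. - [:0, eps_inv m:] * E 0 1 r c)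
      else E 1 1)"

definition tt_loc :: "nat \<Rightarrow> nat \<Rightarrow> nat \<Rightarrow> laurent poly mat2" where
  "tt_loc m i j =
     (if (i, j) = (0, 0) then (\<lambda>r c. (1 + [:0, eps m:]) * E 0 0 r c + E 1 1 r c)
      else if (i, j) = (0, 1) then (\<lambda>r c. - [:0, eps m:] * E 1 0 r c)
      else if (i, j) = (1, 0) then E 0 1
      else E 0 0)"

text \<open>
  With \<open>k\<^sub>0 = j\<close> and \<open>k\<^sub>n = i\<close>, the list position \<open>q\<close>, that is tensor factor number \<open>q + 1\<close>, carries
  the local operator with variable index \<open>n - q\<close> and matrix index \<open>(k\<^bsub>q+1\<^esub>, k\<^sub>q)\<close>.
\<close>

definition monodromy ::
  "(nat \<Rightarrow> nat \<Rightarrow> nat \<Rightarrow> laurent poly mat2) \<Rightarrow> nat \<Rightarrow> nat \<Rightarrow> nat \<Rightarrow>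
     laurent poly vec \<Rightarrow> laurent poly vec" where
  "monodromy L n i j f =
     (\<lambda>b. \<Sum>ks\<in>words (n - 1).
        tensor_op n (\<lambda>q. L (n - q) ((j # ks @ [i]) ! (q + 1)) ((j # ks @ [i]) ! q)) f b)"

definition t_op :: "nat \<Rightarrow> nat \<Rightarrow> nat \<Rightarrow> laurent poly vec \<Rightarrow> laurent poly vec" where
  "t_op = monodromy t_loc"

definition tt_op :: "nat \<Rightarrow> nat \<Rightarrow> nat \<Rightarrow> laurent poly vec \<Rightarrow> laurent poly vec" where
  "tt_op = monodromy tt_loc"

text \<open>Polynomials in \<open>z\<close> with coefficients in \<open>V n\<close>.\<close>

definition Vz :: "nat \<Rightarrow> laurent poly vec set" where
  "Vz n = {f. (\<forall>a m. coeff (f a) m \<in> Rep_T n) \<and> (\<forall>a. a \<notin> words n \<longrightarrow> f a = 0)}"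

text \<open>
  The extension of an operator that acts trivially on \<open>z\<close>, i.e. coefficientwise. If \<open>A\<close> preserves
  zero then the coefficient sequence is eventually zero, so \<open>Abs_poly\<close> is meaningful.
\<close>

definition ext_z :: "(laurent vec \<Rightarrow> laurent vec) \<Rightarrow> laurent poly vec \<Rightarrow> laurent poly vec" where
  "ext_z A f = (\<lambda>b. Abs_poly (\<lambda>m. A (\<lambda>a. coeff (f a) m) b))"

lemma finite_words: "finite (words n)"
  unfolding words_def using finite_lists_length_eq[of "{0, 1 :: nat}" n] by (simp add: conj_commute)

lemma coeff_ext_z:
  assumes "f \<in> Vz n" "A (\<lambda>_. 0) = (\<lambda>_. 0)"
  shows "coeff (ext_z A f b) m = A (\<lambda>a. coeff (f a) m) b"
proof -
  define d where "d = (\<Sum>a\<in>words n. degree (f a))"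
  have "coeff (f a) k = 0" if "k > d" for a k
  proof (cases "a \<in> words n")
    case True
    then have "degree (f a) \<le> d"
      unfolding d_def by (intro member_le_sum) (auto simp: finite_words)
    with that show ?thesis by (simp add: coeff_eq_0)
  next
    case False
    with assms(1) show ?thesis by (simp add: Vz_def)
  qed
  then have "A (\<lambda>a. coeff (f a) k) b = 0" if "k > d" for k
    using that assms(2) by simp
  then show ?thesis
    unfolding ext_z_def by (subst coeff_Abs_poly[of d]) auto
qed

end

theory Submission
  imports Defs
begin

text \<open>
  The action is a local formula on words, and its Coxeter relations are case checks on at most four
  letters. They give an action of \<open>S\<^sub>n\<close> because every permutation is uniquely
  \<open>s\<^sub>j s\<^sub>j\<^sub>+\<^sub>1 \<dots> s\<^sub>n\<^sub>-\<^sub>1 u\<close> with \<open>u\<close> in \<open>S\<^sub>n\<^sub>-\<^sub>1\<close>, and left multiplication by a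
  simple transposition changes this normal form only through the relations. The operators \<open>t\<^sub>i\<^sub>j(z)\<close>
  satisfy a recursion in the first letter of a word, by which commutation with the action reduces to
  the RLL relation for two adjacent factors whose variables are exchanged.
\<close>

section \<open>Coxeter generators of the symmetric group\<close>

text \<open>An action of the whole group is demanded while only the generators are given, so the
  Coxeter presentation of the symmetric group has to be proved as a statement about extending maps.
  Conversely, an arbitrary action is known only through its values on generators; invariance and
  commutation therefore pass to a general permutation by induction along products of simple
  transpositions.

  The operators \<open>bold_s\<close> are not linear over the Laurent ring but twisted by the
  exchange of two variables. \<open>braid_op\<close> keeps the twist \<sigma> and the argument of
  the R-matrix as parameters: the identity twist gives the bare R-matrix,
  \<open>perm_laurent\<close> the action itself, and its coefficientwise version the extension to
  polynomials in the spectral parameter. In the commutation proof the twist interchanges the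
  variables of two adjacent local operators, and the R-matrix interchanges them back.\<close>

declare One_nat_def [simp del]

abbreviation adj :: "nat \<Rightarrow> nat \<Rightarrow> nat" where
  "adj i \<equiv> Transposition.transpose i (Suc i)"

definition coxeter_tuple :: "('g, 'b) monoid_scheme \<Rightarrow> nat \<Rightarrow> (nat \<Rightarrow> 'g) \<Rightarrow> bool" where
  "coxeter_tuple G n s \<longleftrightarrow>
     (\<forall>i\<in>{1..<n}. s i \<in> carrier G \<and> s i \<otimes>\<^bsub>G\<^esub> s i = \<one>\<^bsub>G\<^esub>) \<and>
     (\<forall>i\<ge>1. Suc i < n \<longrightarrow>
        s i \<otimes>\<^bsub>G\<^esub> (s (Suc i) \<otimes>\<^bsub>G\<^esub> s i) = s (Suc i) \<otimes>\<^bsub>G\<^esub> (s i \<otimes>\<^bsub>G\<^esub> s (Suc i))) \<and>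
     (\<forall>i\<ge>1. \<forall>j<n. Suc i < j \<longrightarrow> s i \<otimes>\<^bsub>G\<^esub> s j = s j \<otimes>\<^bsub>G\<^esub> s i)"

text \<open>For the simple transpositions these are the minimal representatives of the left cosets
  of the stabilizer of \<open>n\<close>; the index \<open>j\<close> is the image of
  \<open>n\<close>.\<close>

definition gen_prod :: "('g, 'b) monoid_scheme \<Rightarrow> (nat \<Rightarrow> 'g) \<Rightarrow> nat \<Rightarrow> nat \<Rightarrow> 'g" where
  "gen_prod G s n j = foldr (\<lambda>i x. s i \<otimes>\<^bsub>G\<^esub> x) [j..<n] \<one>\<^bsub>G\<^esub>"

lemma gen_prod_unfold: "j < n \<Longrightarrow> gen_prod G s n j = s j \<otimes>\<^bsub>G\<^esub> gen_prod G s n (Suc j)"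
  by (simp add: gen_prod_def upt_conv_Cons)

lemma gen_prod_self [simp]: "gen_prod G s n n = \<one>\<^bsub>G\<^esub>"
  by (simp add: gen_prod_def)

lemma coxeter_tuple_mono: "coxeter_tuple G n s \<Longrightarrow> m \<le> n \<Longrightarrow> coxeter_tuple G m s"
  by (auto simp: coxeter_tuple_def)

context group
begin

context
  fixes n :: nat and s :: "nat \<Rightarrow> 'a"
  assumes cox: "coxeter_tuple G n s"
begin

lemma gen_closed: "1 \<le> i \<Longrightarrow> i < n \<Longrightarrow> s i \<in> carrier G"
  using cox by (simp add: coxeter_tuple_def)

lemma gen_square: "1 \<le> i \<Longrightarrow> i < n \<Longrightarrow> s i \<otimes> s i = \<one>"
  using cox by (simp add: coxeter_tuple_def)

lemma gen_braid: "1 \<le> i \<Longrightarrow> Suc i < n \<Longrightarrow> s i \<otimes> (s (Suc i) \<otimes> s i) = s (Suc i) \<otimes> (s i \<otimes> s (Suc i))"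
  using cox by (simp add: coxeter_tuple_def)

lemma gen_commute: "1 \<le> i \<Longrightarrow> Suc i < j \<Longrightarrow> j < n \<Longrightarrow> s i \<otimes> s j = s j \<otimes> s i"
  using cox by (auto simp: coxeter_tuple_def)

lemma gen_prod_closed: "j \<le> n \<Longrightarrow> 1 \<le> j \<Longrightarrow> gen_prod G s n j \<in> carrier G"
proof (induction j rule: inc_induct)
  case (step j)
  then show ?case
    by (simp add: gen_prod_unfold gen_closed)
qed simp

lemma gen_prod_commute:
  "j \<le> n \<Longrightarrow> 1 \<le> i \<Longrightarrow> Suc i < j \<Longrightarrow> s i \<otimes> gen_prod G s n j = gen_prod G s n j \<otimes> s i"
proof (induction j rule: inc_induct)
  case base
  then show ?case by (simp add: gen_closed)
next
  case (step j)
  have c: "s i \<in> carrier G" "s j \<in> carrier G" "gen_prod G s n (Suc j) \<in> carrier G"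
    using step.hyps step.prems by (auto intro: gen_closed gen_prod_closed)
  have "s i \<otimes> gen_prod G s n j = s j \<otimes> (s i \<otimes> gen_prod G s n (Suc j))"
    using step.hyps step.prems gen_commute[of i j] c by (simp add: gen_prod_unfold flip: m_assoc)
  also have "\<dots> = gen_prod G s n j \<otimes> s i"
    using step c by (simp add: gen_prod_unfold m_assoc)
  finally show ?case .
qed

text \<open>The generator with index \<open>i + 1\<close> commutes with everything in the product up
  to index \<open>i - 1\<close>, the braid relation turns it into the one with index
  \<open>i\<close>, and that commutes with the remaining factors.\<close>

lemma gen_prod_shift:
  assumes "Suc i < n" "1 \<le> j" "j \<le> i"
  shows "s (Suc i) \<otimes> gen_prod G s n j = gen_prod G s n j \<otimes> s i"
  using assms(3,2)
proof (induction j rule: inc_induct)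
  case base
  have c: "s i \<in> carrier G" "s (Suc i) \<in> carrier G" "gen_prod G s n (Suc (Suc i)) \<in> carrier G"
    using assms base by (auto intro: gen_closed gen_prod_closed)
  have "s (Suc i) \<otimes> gen_prod G s n i = s (Suc i) \<otimes> (s i \<otimes> s (Suc i)) \<otimes> gen_prod G s n (Suc (Suc i))"
    using c assms(1) by (simp add: gen_prod_unfold m_assoc)
  also have "\<dots> = s i \<otimes> (s (Suc i) \<otimes> (s i \<otimes> gen_prod G s n (Suc (Suc i))))"
    using c assms(1) base gen_braid[of i] by (simp flip: m_assoc)
  also have "\<dots> = gen_prod G s n i \<otimes> s i"
    using c assms(1) base gen_prod_commute[of "Suc (Suc i)" i] by (simp add: gen_prod_unfold m_assoc)
  finally show ?case .
next
  case (step j)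
  have c: "s (Suc i) \<in> carrier G" "s i \<in> carrier G" "s j \<in> carrier G" "gen_prod G s n (Suc j) \<in> carrier G"
    using assms step by (auto intro: gen_closed gen_prod_closed)
  have "s (Suc i) \<otimes> gen_prod G s n j = s j \<otimes> (s (Suc i) \<otimes> gen_prod G s n (Suc j))"
    using assms step.hyps step.prems gen_commute[of j "Suc i"] c
    by (simp add: gen_prod_unfold flip: m_assoc)
  also have "\<dots> = gen_prod G s n j \<otimes> s i"
    using assms step c by (simp add: gen_prod_unfold m_assoc)
  finally show ?case .
qed

text \<open>A generator either moves to a neighbouring coset representative or emerges on the right
  as a generator of the smaller group. The same table thus governs the symmetric group and any group
  with a Coxeter tuple.\<close>

lemma gen_mult_gen_prod:
  assumes "1 \<le> i" "i < n" "1 \<le> j" "j \<le> n"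
  shows "s i \<otimes> gen_prod G s n j =
    (if Suc i < j then gen_prod G s n j \<otimes> s i
     else if Suc i = j then gen_prod G s n i
     else if i = j then gen_prod G s n (Suc i)
     else gen_prod G s n j \<otimes> s (i - 1))"
proof -
  consider "Suc i < j" | "Suc i = j" | "i = j" | k where "i = Suc k" "j \<le> k"
    using assms by (metis Suc_lessI linorder_neqE_nat not_less_eq_eq less_imp_Suc_add le_add1 less_or_eq_imp_le)
  then show ?thesis
  proof cases
    case 1 then show ?thesis using assms gen_prod_commute by simp
  next
    case 2 then show ?thesis using assms by (simp add: gen_prod_unfold)
  next
    case 3
    then show ?thesis
      using assms gen_square[of i] gen_closed[of i] gen_prod_closed[of "Suc i"]
      by (simp add: gen_prod_unfold flip: m_assoc)
  next
    case 4 then show ?thesis using assms gen_prod_shift[of k j] by simp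
  qed
qed

end

end

section \<open>Simple transpositions and coset representatives\<close>

lemma adj_permutes: "1 \<le> i \<Longrightarrow> i < n \<Longrightarrow> adj i permutes {1..n}"
  by (intro permutes_swap_id) auto

lemma adj_braid: "adj i \<circ> (adj (Suc i) \<circ> adj i) = adj (Suc i) \<circ> (adj i \<circ> adj (Suc i))"
  by (auto simp: fun_eq_iff Transposition.transpose_def)

lemma adj_commute: "Suc i < j \<Longrightarrow> adj i \<circ> adj j = adj j \<circ> adj i"
  by (auto simp: fun_eq_iff Transposition.transpose_def)

lemma coxeter_tuple_adj: "coxeter_tuple (sym_group n) n adj"
  unfolding coxeter_tuple_def sym_group_carrier sym_group_mult sym_group_one
  by (intro conjI ballI allI impI adj_permutes adj_braid adj_commute) auto

lemma gen_prod_adj_permutes: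
  "1 \<le> j \<Longrightarrow> j \<le> n \<Longrightarrow> gen_prod (sym_group n) adj n j permutes {1..n}"
  using group.gen_prod_closed[OF sym_group_is_group coxeter_tuple_adj] by (simp add: sym_group_carrier)

lemma gen_prod_adj_apply: "j \<le> n \<Longrightarrow> gen_prod (sym_group n) adj n j n = j"
proof (induction j rule: inc_induct)
  case (step j)
  then show ?case by (simp add: gen_prod_unfold sym_group_mult)
qed (simp add: sym_group_one)

text \<open>The index \<open>j\<close> is forced to be the image of the last point; dividing by its
  coset representative leaves a permutation that fixes this point.\<close>

lemma permutes_gen_prod_decomp:
  assumes w: "w permutes {1..Suc n}"
  obtains j u where "1 \<le> j" "j \<le> Suc n" "u permutes {1..n}"
    "w = gen_prod (sym_group (Suc n)) adj (Suc n) j \<circ> u"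
proof
  define c where "c = gen_prod (sym_group (Suc n)) adj (Suc n) (w (Suc n))"
  show j: "1 \<le> w (Suc n)" "w (Suc n) \<le> Suc n"
    using permutes_in_image[OF w, of "Suc n"] by simp_all
  have c: "c permutes {1..Suc n}" "c (Suc n) = w (Suc n)"
    unfolding c_def using j by (auto intro: gen_prod_adj_permutes gen_prod_adj_apply)
  have "(inv' c \<circ> w) permutes {1..Suc n}"
    using w c(1) by (simp add: permutes_compose permutes_inv)
  moreover have "(inv' c \<circ> w) (Suc n) = Suc n"
    using c by (metis comp_apply permutes_inverses(2))
  ultimately show "(inv' c \<circ> w) permutes {1..n}"
    by (smt (verit) permutes_superset Diff_iff atLeastAtMost_iff le_Suc_eq)
  show "w = c \<circ> (inv' c \<circ> w)"
    using c(1) by (auto simp: fun_eq_iff permutes_inverses)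
qed

lemma gen_prod_adj_induct:
  assumes "\<And>i w. 1 \<le> i \<Longrightarrow> i < n \<Longrightarrow> w permutes {1..n} \<Longrightarrow> P w \<Longrightarrow> P (adj i \<circ> w)"
    and "P u" "u permutes {1..n}" "1 \<le> j" "j \<le> n"
  shows "P (gen_prod (sym_group n) adj n j \<circ> u)"
  using assms(5,4)
proof (induction j rule: inc_induct)
  case base
  then show ?case using assms by (simp add: sym_group_one)
next
  case (step j)
  have "gen_prod (sym_group n) adj n (Suc j) \<circ> u permutes {1..n}"
    using assms step by (intro permutes_compose[of u] gen_prod_adj_permutes) auto
  then show ?case
    using step assms(1)[of j] by (simp add: gen_prod_unfold sym_group_mult o_def)
qed

lemma permutes_adj_induct [consumes 1, case_names id adj]:
  assumes "w permutes {1..n}" "P id"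
    and "\<And>i w. 1 \<le> i \<Longrightarrow> i < n \<Longrightarrow> w permutes {1..n} \<Longrightarrow> P w \<Longrightarrow> P (adj i \<circ> w)"
  shows "P w"
  using assms(1,3)
proof (induction n arbitrary: w)
  case 0
  then show ?case using assms(2) by (simp add: id_def)
next
  case (Suc n)
  obtain j u where ju: "1 \<le> j" "j \<le> Suc n" "u permutes {1..n}"
    "w = gen_prod (sym_group (Suc n)) adj (Suc n) j \<circ> u"
    using permutes_gen_prod_decomp[OF Suc.prems(1)] .
  have sub: "v permutes {1..Suc n}" if "v permutes {1..n}" for v
    using that by (rule permutes_subset) auto
  have "P u"
    by (rule Suc.IH[OF ju(3)], rule Suc.prems(2)) (auto intro: sub)
  then show ?case
    unfolding ju(4) using gen_prod_adj_induct[of "Suc n" P, OF Suc.prems(2)] ju(1,2) sub[OF ju(3)] by blast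
qed

text \<open>Only left multiplication by generators is tracked, because this is what the table for
  coset representatives controls. Well-definedness costs nothing, since both parts of the normal
  form are read off from the permutation; the relations enter in the compatibility with
  generators.\<close>

lemma (in group) coxeter_extension_exists:
  assumes "coxeter_tuple G n s"
  shows "\<exists>h. h id = \<one> \<and> (\<forall>w. w permutes {1..n} \<longrightarrow> h w \<in> carrier G) \<and>
             (\<forall>i w. 1 \<le> i \<longrightarrow> i < n \<longrightarrow> w permutes {1..n} \<longrightarrow> h (adj i \<circ> w) = s i \<otimes> h w)"
  using assms
proof (induction n)
  case 0
  show ?case by (intro exI[of _ "\<lambda>_. \<one>"]) auto
next
  case (Suc n)
  let ?N = "Suc n"
  define c where "c = gen_prod (sym_group ?N) adj ?N"
  define C where "C = gen_prod G s ?N"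
  obtain h where h: "h id = \<one>" "\<And>w. w permutes {1..n} \<Longrightarrow> h w \<in> carrier G"
    "\<And>i w. 1 \<le> i \<Longrightarrow> i < n \<Longrightarrow> w permutes {1..n} \<Longrightarrow> h (adj i \<circ> w) = s i \<otimes> h w"
    using Suc.IH[OF coxeter_tuple_mono[OF Suc.prems]] unfolding o_def id_def by auto
  define h' where "h' = (\<lambda>w. C (w ?N) \<otimes> h (inv' (c (w ?N)) \<circ> w))"
  have key: "h' (c j \<circ> u) = C j \<otimes> h u" if "1 \<le> j" "j \<le> ?N" "u permutes {1..n}" for j u
  proof -
    have "u ?N = ?N" using that(3) by (simp add: permutes_def)
    moreover have "inv' (c j) \<circ> (c j \<circ> u) = u"
      using that gen_prod_adj_permutes[of j ?N] by (auto simp: c_def fun_eq_iff permutes_inverses)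
    ultimately show ?thesis
      using that by (simp add: h'_def c_def gen_prod_adj_apply)
  qed
  have Cc: "C j \<in> carrier G" if "1 \<le> j" "j \<le> ?N" for j
    using gen_prod_closed[OF Suc.prems] that by (simp add: C_def)
  note sc = gen_closed[OF Suc.prems]
  have "h' id = \<one>"
    using key[of ?N id] h(1) by (simp add: c_def C_def sym_group_one)
  moreover have "h' w \<in> carrier G" if w: "w permutes {1..?N}" for w
  proof -
    obtain j u where "1 \<le> j" "j \<le> ?N" "u permutes {1..n}" "w = c j \<circ> u"
      using permutes_gen_prod_decomp[OF w] unfolding c_def .
    then show ?thesis using key h(2) Cc by simp
  qed
  moreover have "h' (adj i \<circ> w) = s i \<otimes> h' w"
    if i: "1 \<le> i" "i < ?N" and w: "w permutes {1..?N}" for i w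
  proof -
    obtain j u where ju: "1 \<le> j" "j \<le> ?N" "u permutes {1..n}" "w = c j \<circ> u"
      using permutes_gen_prod_decomp[OF w] unfolding c_def .
    \<comment> \<open>The normal form of \<open>adj i \<circ> w\<close>, as dictated by the four
      cases of \<open>gen_mult_gen_prod\<close>.\<close>
    define v where "v = (if Suc i < j then (j, adj i \<circ> u) else if Suc i = j then (i, u)
        else if i = j then (Suc i, u) else (j, adj (i - 1) \<circ> u))"
    have perm: "snd v permutes {1..n}"
    proof -
      have "adj i \<circ> u permutes {1..n}" if "i < n"
        using that i(1) by (intro permutes_compose[OF ju(3)] adj_permutes)
      moreover have "adj (i - 1) \<circ> u permutes {1..n}" if "j < i"
        using that i ju(1) by (intro permutes_compose[OF ju(3)] adj_permutes) linarith+
      ultimately show ?thesis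
        using i ju(2,3) by (simp add: v_def)
    qed
    have range: "1 \<le> fst v" "fst v \<le> ?N"
      using i ju by (auto simp: v_def)
    have "adj i \<circ> w = c (fst v) \<circ> snd v"
      using group.gen_mult_gen_prod[OF sym_group_is_group coxeter_tuple_adj i ju(1,2)]
      by (auto simp: v_def ju(4) c_def sym_group_mult simp flip: comp_assoc)
    then have "h' (adj i \<circ> w) = C (fst v) \<otimes> h (snd v)"
      using key perm range by simp
    also have "\<dots> = s i \<otimes> C j \<otimes> h u"
    \<comment> \<open>For \<open>j < i\<close> the generator reappears on the right with its index
      lowered by one, hence inside the smaller group where \<open>h\<close> is already compatible
      with it.\<close>
    proof (cases "j < i")
      case True
      then obtain k where k: "i = Suc k" "j \<le> k"
        by (cases i) auto
      have "1 \<le> k" "k < n" "s k \<in> carrier G" "fst v = j" "snd v = adj k \<circ> u" "s i \<otimes> C j = C j \<otimes> s k"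
        using gen_mult_gen_prod[OF Suc.prems i ju(1,2)] sc[of k] k i ju(1) by (simp_all add: v_def C_def)
      then show ?thesis
        using h(2,3) ju Cc by (simp add: m_assoc)
    next
      case False
      then show ?thesis
        using gen_mult_gen_prod[OF Suc.prems i ju(1,2)] i ju h(2,3) Cc sc
        by (auto simp: v_def C_def m_assoc)
    qed
    also have "\<dots> = s i \<otimes> h' w"
      using i ju h(2) Cc sc key by (simp add: m_assoc)
    finally show ?thesis .
  qed
  ultimately show ?case by blast
qed

text \<open>Induction on the left factor upgrades compatibility with generators to
  multiplicativity.\<close>

theorem (in group) coxeter_tuple_hom_exists:
  assumes "coxeter_tuple G n s"
  shows "\<exists>h\<in>hom (sym_group n) G. \<forall>i\<in>{1..<n}. h (adj i) = s i"
proof -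
  obtain h where h: "h id = \<one>" "\<And>w. w permutes {1..n} \<Longrightarrow> h w \<in> carrier G"
    "\<And>i w. 1 \<le> i \<Longrightarrow> i < n \<Longrightarrow> w permutes {1..n} \<Longrightarrow> h (adj i \<circ> w) = s i \<otimes> h w"
    using coxeter_extension_exists[OF assms] by blast
  have "h (v \<circ> w) = h v \<otimes> h w" if "v permutes {1..n}" "w permutes {1..n}" for v w
    using that(1)
  proof (induction v rule: permutes_adj_induct)
    case id
    then show ?case using h(1,2) that(2) by (metis id_comp l_one)
  next
    case (adj i v)
    have "h (adj i \<circ> (v \<circ> w)) = s i \<otimes> (h v \<otimes> h w)"
      using adj h(3)[of i "v \<circ> w"] permutes_compose[OF that(2) adj(3)] by (simp add: o_def)
    also have "\<dots> = h (adj i \<circ> v) \<otimes> h w"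
      using adj h(2,3) that(2) gen_closed[OF assms] by (simp add: m_assoc)
    finally show ?case by (simp add: o_def)
  qed
  then have "h \<in> hom (sym_group n) G"
    using h by (auto simp: hom_def sym_group_carrier sym_group_mult)
  moreover have "h (adj i) = s i" if "i \<in> {1..<n}" for i
    using h(3)[of i id] h(1) that gen_closed[OF assms, of i] by (simp add: permutes_id)
  ultimately show ?thesis by blast
qed

section \<open>Permutations of the variables\<close>

lemma poly_mapping_add_single_induct [case_names zero add_single]:
  fixes f :: "'a \<Rightarrow>\<^sub>0 'b::monoid_add"
  assumes "P 0" "\<And>f a b. P f \<Longrightarrow> P (f + Poly_Mapping.single a b)"
  shows "P f"
proof (induction f rule: Poly_Mapping.update_induct)
  case (update f a b)
  have "Poly_Mapping.update a b f = f + Poly_Mapping.single a b"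
    using update(1) by (intro poly_mapping_eqI) (auto simp: lookup_add update.rep_eq lookup_single when_def in_keys_iff)
  then show ?case using update assms(2) by simp
qed (rule assms)

text \<open>\<open>perm_laurent\<close> applies \<open>map_key\<close> to
  \<open>map_key \<sigma>\<close> itself, and the value of \<open>map_key\<close> is under control
  only for an injective argument.\<close>

lemma inj_map_key: "bij \<sigma> \<Longrightarrow> inj (Poly_Mapping.map_key \<sigma> :: ('a \<Rightarrow>\<^sub>0 'b::zero) \<Rightarrow> 'a \<Rightarrow>\<^sub>0 'b)"
proof (rule injI, rule poly_mapping_eqI)
  fix p q :: "'a \<Rightarrow>\<^sub>0 'b" and k
  assume \<sigma>: "bij \<sigma>" and eq: "Poly_Mapping.map_key \<sigma> p = Poly_Mapping.map_key \<sigma> q"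
  have "inj \<sigma>" using \<sigma> by (rule bij_is_inj)
  then have "Poly_Mapping.lookup p (\<sigma> l) = Poly_Mapping.lookup q (\<sigma> l)" for l
    using arg_cong[OF eq, of "\<lambda>r. Poly_Mapping.lookup r l"] by (simp add: map_key.rep_eq)
  then show "Poly_Mapping.lookup p k = Poly_Mapping.lookup q k"
    using \<sigma> by (metis bij_pointE)
qed

context
  fixes \<sigma> :: "nat \<Rightarrow> nat"
  assumes \<sigma>: "bij \<sigma>"
begin

lemma lookup_perm_laurent:
  "Poly_Mapping.lookup (perm_laurent \<sigma> \<chi>) m = Poly_Mapping.lookup \<chi> (Poly_Mapping.map_key \<sigma> m)"
  using \<sigma> by (simp add: perm_laurent_def inj_map_key map_key.rep_eq)

lemma perm_laurent_0: "perm_laurent \<sigma> 0 = 0"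
  by (rule poly_mapping_eqI) (simp add: lookup_perm_laurent)

lemma perm_laurent_add: "perm_laurent \<sigma> (\<chi> + \<psi>) = perm_laurent \<sigma> \<chi> + perm_laurent \<sigma> \<psi>"
  by (rule poly_mapping_eqI) (simp add: lookup_perm_laurent lookup_add)

lemma perm_laurent_minus: "perm_laurent \<sigma> (- \<chi>) = - perm_laurent \<sigma> \<chi>"
  by (rule poly_mapping_eqI) (simp add: lookup_perm_laurent)

lemma perm_laurent_diff: "perm_laurent \<sigma> (\<chi> - \<psi>) = perm_laurent \<sigma> \<chi> - perm_laurent \<sigma> \<psi>"
  by (rule poly_mapping_eqI) (simp add: lookup_perm_laurent lookup_minus)

text \<open>By biadditivity this reduces to monomials, where it is additivity of the relabelling of
  exponent vectors.\<close>

lemma perm_laurent_mult: "perm_laurent \<sigma> (\<chi> * \<psi>) = perm_laurent \<sigma> \<chi> * perm_laurent \<sigma> \<psi>"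
proof -
  have "inj (inv' \<sigma>)"
    using \<sigma> by (simp add: bij_imp_bij_inv bij_is_inj)
  then have single: "perm_laurent \<sigma> (Poly_Mapping.single k v * Poly_Mapping.single l w) =
      perm_laurent \<sigma> (Poly_Mapping.single k v) * perm_laurent \<sigma> (Poly_Mapping.single l w)" for k v l w
    using \<sigma> by (simp add: perm_laurent_monomial mult_single map_key_plus)
  have "perm_laurent \<sigma> (Poly_Mapping.single k v * \<psi>) =
      perm_laurent \<sigma> (Poly_Mapping.single k v) * perm_laurent \<sigma> \<psi>" for k v
    by (induction \<psi> rule: poly_mapping_add_single_induct)
      (simp_all add: perm_laurent_0 perm_laurent_add distrib_left single)
  then show ?thesis
    by (induction \<chi> rule: poly_mapping_add_single_induct)
      (simp_all add: perm_laurent_0 perm_laurent_add distrib_right)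
qed

lemma perm_laurent_eps_inv: "perm_laurent \<sigma> (eps_inv i) = eps_inv (\<sigma> i)"
proof -
  have "Poly_Mapping.map_key (inv' \<sigma>) (Poly_Mapping.single i (-1::int)) = Poly_Mapping.single (\<sigma> i) (-1)"
    using \<sigma> map_key_single[of "inv' \<sigma>" "\<sigma> i" "-1::int"]
    by (simp add: bij_imp_bij_inv bij_is_inj)
  then show ?thesis
    using \<sigma> by (simp add: eps_inv_def perm_laurent_monomial)
qed

lemma perm_laurent_1: "perm_laurent \<sigma> 1 = 1"
  \<comment> \<open>The unit is written as a variable times its inverse; index 0 is available
    because the ambient ring has a variable for every natural number.\<close>
  using perm_laurent_mult[of "eps 0" "eps_inv 0"] \<sigma>
  by (simp add: eps_eps_inv perm_laurent_eps perm_laurent_eps_inv)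

lemma perm_laurent_in_Rep_T:
  assumes "\<sigma> permutes {1..n}" "\<chi> \<in> Rep_T n"
  shows "perm_laurent \<sigma> \<chi> \<in> Rep_T n"
  unfolding Rep_T_def
proof (intro CollectI ballI subsetI)
  fix m k
  assume m: "m \<in> Poly_Mapping.keys (perm_laurent \<sigma> \<chi>)" and k: "k \<in> Poly_Mapping.keys m"
  have "Poly_Mapping.map_key \<sigma> m \<in> Poly_Mapping.keys \<chi>"
    using m by (simp add: in_keys_iff lookup_perm_laurent)
  then have "Poly_Mapping.keys (Poly_Mapping.map_key \<sigma> m) \<subseteq> {1..n}"
    using assms(2) by (auto simp: Rep_T_def)
  moreover have "inv' \<sigma> k \<in> Poly_Mapping.keys (Poly_Mapping.map_key \<sigma> m)"
    using k \<sigma> by (simp add: keys_map_key bij_is_inj bij_is_surj surj_f_inv_f)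
  ultimately have "inv' \<sigma> k \<in> {1..n}"
    by blast
  then show "k \<in> {1..n}"
    using permutes_in_image[OF permutes_inv[OF assms(1)], of k] by simp
qed

end

lemma perm_laurent_comp:
  assumes "bij \<sigma>" "bij \<tau>"
  shows "perm_laurent \<sigma> (perm_laurent \<tau> \<chi>) = perm_laurent (\<sigma> \<circ> \<tau>) \<chi>"
proof (rule poly_mapping_eqI)
  fix m :: "nat \<Rightarrow>\<^sub>0 int"
  show "Poly_Mapping.lookup (perm_laurent \<sigma> (perm_laurent \<tau> \<chi>)) m
      = Poly_Mapping.lookup (perm_laurent (\<sigma> \<circ> \<tau>) \<chi>) m"
    using assms bij_comp[OF assms(2,1)] by (simp add: lookup_perm_laurent map_key_compose bij_is_inj)
qed

lemma perm_laurent_id: "perm_laurent id \<chi> = \<chi>"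
proof (rule poly_mapping_eqI)
  show "Poly_Mapping.lookup (perm_laurent id \<chi>) m = Poly_Mapping.lookup \<chi> m" for m
    using lookup_perm_laurent[OF bij_id, of \<chi> m] map_key_id[of m] by (simp add: id_def)
qed

section \<open>Closure properties of the Laurent ring in \<open>n\<close> variables\<close>

lemma Rep_T_0: "0 \<in> Rep_T n"
  by (simp add: Rep_T_def)

lemma Rep_T_1: "1 \<in> Rep_T n"
  by (simp add: Rep_T_def)

lemma Rep_T_add: "\<chi> \<in> Rep_T n \<Longrightarrow> \<psi> \<in> Rep_T n \<Longrightarrow> \<chi> + \<psi> \<in> Rep_T n"
  using keys_add[of \<chi> \<psi>] by (fastforce simp: Rep_T_def)

lemma Rep_T_minus: "\<chi> \<in> Rep_T n \<Longrightarrow> - \<chi> \<in> Rep_T n"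
  by (simp add: Rep_T_def)

lemma Rep_T_diff: "\<chi> \<in> Rep_T n \<Longrightarrow> \<psi> \<in> Rep_T n \<Longrightarrow> \<chi> - \<psi> \<in> Rep_T n"
  using Rep_T_add[of \<chi> n "- \<psi>"] Rep_T_minus by simp

lemma Rep_T_mult:
  assumes "\<chi> \<in> Rep_T n" "\<psi> \<in> Rep_T n"
  shows "\<chi> * \<psi> \<in> Rep_T n"
  unfolding Rep_T_def
proof (intro CollectI ballI)
  fix m assume "m \<in> Poly_Mapping.keys (\<chi> * \<psi>)"
  then obtain a b where "m = a + b" "a \<in> Poly_Mapping.keys \<chi>" "b \<in> Poly_Mapping.keys \<psi>"
    using keys_mult[of \<chi> \<psi>] by blast
  then show "Poly_Mapping.keys m \<subseteq> {1..n}"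
    using assms keys_add[of a b] by (fastforce simp: Rep_T_def)
qed

lemma Rep_T_sum: "(\<And>x. x \<in> A \<Longrightarrow> g x \<in> Rep_T n) \<Longrightarrow> sum g A \<in> Rep_T n"
  by (induction A rule: infinite_finite_induct) (auto intro: Rep_T_0 Rep_T_add)

lemma eps_in_Rep_T: "i \<in> {1..n} \<Longrightarrow> eps i \<in> Rep_T n"
  by (simp add: Rep_T_def eps_def)

lemma eps_inv_in_Rep_T: "i \<in> {1..n} \<Longrightarrow> eps_inv i \<in> Rep_T n"
  by (simp add: Rep_T_def eps_inv_def)

lemma \<alpha>_in_Rep_T: "1 \<le> i \<Longrightarrow> i < n \<Longrightarrow> \<alpha> i \<in> Rep_T n"
  unfolding \<alpha>_def by (intro Rep_T_mult eps_in_Rep_T eps_inv_in_Rep_T) auto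

section \<open>The action on words\<close>

text \<open>The position of the operator is counted from the end of the word, as in \<open>J\<close>, so that the
  number of tensor factors does not enter.\<close>

definition braid_op :: "('a \<Rightarrow> 'a) \<Rightarrow> 'a \<Rightarrow> nat \<Rightarrow> 'a::comm_ring_1 vec \<Rightarrow> 'a vec" where
  "braid_op \<sigma> z i f b = (let p = length b - i in
     if b ! (p - 1) = 0 \<and> b ! p = 1 then z * \<sigma> (f b)
     else if b ! (p - 1) = 1 \<and> b ! p = 0 then \<sigma> (f b) + (1 - z) * \<sigma> (f (b[p - 1 := 0, p := 1]))
     else \<sigma> (f b))"

lemma braid_op_split:
  assumes "i = Suc (length ys)"
  shows "braid_op \<sigma> z i f (xs @ x # y # ys) =
    (if x = 0 \<and> y = 1 then z * \<sigma> (f (xs @ 0 # 1 # ys))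
     else if x = 1 \<and> y = 0 then \<sigma> (f (xs @ 1 # 0 # ys)) + (1 - z) * \<sigma> (f (xs @ 0 # 1 # ys))
     else \<sigma> (f (xs @ x # y # ys)))"
  using assms by (auto simp: braid_op_def Let_def nth_append list_update_append Suc_diff_le split: if_splits)

lemma split_at_two:
  assumes "1 \<le> i" "i < length b"
  obtains xs x y ys where "b = xs @ x # y # ys" "i = Suc (length ys)"
proof
  let ?p = "length b - i"
  have "?p - 1 < length b" "Suc (?p - 1) = ?p" "?p < length b"
    using assms by auto
  then show "b = take (?p - 1) b @ b ! (?p - 1) # b ! ?p # drop (Suc ?p) b"
    by (metis append_take_drop_id Cons_nth_drop_Suc)
  show "i = Suc (length (drop (Suc ?p) b))"
    using assms by auto
qed

lemma words_2: "words 2 = {[0, 0], [0, 1], [1, 0], [1, 1]}"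
  by (auto simp: words_def numeral_2_eq_2 length_Suc_conv)

lemma R_check_entry:
  assumes "u \<in> {0, 1}" "v \<in> {0, 1}" "x \<in> {0, 1}" "y \<in> {0, 1}"
  shows "R_check z (basis [u, v]) [x, y] =
    (if u = 0 \<and> v = 1 then z * basis [0, 1] [x, y] + (1 - z) * basis [1, 0] [x, y] else basis [u, v] [x, y])"
  using assms by (auto simp: R_check_def R_def flip_def lin_def words_2 basis_def)

lemma sum_pairs:
  fixes h :: "nat \<Rightarrow> nat \<Rightarrow> 'a::comm_monoid_add"
  shows "(\<Sum>(u, v)\<in>{0, 1} \<times> {0, 1}. h u v) = h 0 0 + h 0 1 + (h 1 0 + h 1 1)"
  unfolding sum.cartesian_product[symmetric] by simp

lemma words_subset: "a \<in> words n \<Longrightarrow> c \<in> set a \<Longrightarrow> c \<in> {0, 1}"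
  by (auto simp: words_def)

text \<open>The twist is the identity here, so this concerns the R-matrix alone. Its matrix entries
  vanish unless both words agree outside the two factors, which leaves four summands.\<close>

lemma R_check_at_split:
  assumes w: "xs @ x # y # ys \<in> words n" and p: "p = Suc (length xs)"
  shows "R_check_at n p z g (xs @ x # y # ys) = braid_op (\<lambda>c. c) z (Suc (length ys)) g (xs @ x # y # ys)"
proof -
  let ?b = "xs @ x # y # ys" and ?h = "\<lambda>(u, v). xs @ u # v # ys"
  let ?A = "?h ` ({0, 1} \<times> {0, 1})"
  define F where "F = (\<lambda>a. g a *
    (if ?b \<in> words n \<and> take (p - 1) ?b = take (p - 1) a \<and> drop (p + 1) ?b = drop (p + 1) a
     then R_check z (basis [a ! (p - 1), a ! p]) [?b ! (p - 1), ?b ! p] else 0))"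
  have xy: "x \<in> {0, 1}" "y \<in> {0, 1}"
    using w by (auto simp: words_def)
  have "R_check_at n p z g ?b = sum F (words n)"
    by (simp add: R_check_at_def lin_def F_def)
  also have "\<dots> = sum F ?A"
  proof (rule sum.mono_neutral_right)
    show "?A \<subseteq> words n" using w by (auto simp: words_def)
    show "\<forall>a\<in>words n - ?A. F a = 0"
    proof
      fix a assume a: "a \<in> words n - ?A"
      \<comment> \<open>A word that agrees with \<open>?b\<close> outside the two positions is
        determined by its two letters there, and so would lie in \<open>?A\<close>.\<close>
      have "\<not> (take (p - 1) ?b = take (p - 1) a \<and> drop (p + 1) ?b = drop (p + 1) a)"
      proof
        assume "take (p - 1) ?b = take (p - 1) a \<and> drop (p + 1) ?b = drop (p + 1) a"
        then have eq: "xs = take (length xs) a" "ys = drop (Suc (Suc (length xs))) a"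
          unfolding p by (simp_all add: One_nat_def)
        have len: "Suc (length xs) < length a"
          using a w by (auto simp: words_def)
        then have a_eq: "xs @ a ! length xs # a ! Suc (length xs) # ys = a"
          using id_take_nth_drop[OF Suc_lessD[OF len]] Cons_nth_drop_Suc[OF len] eq by simp
        have aw: "a \<in> words n"
          using a by (rule DiffD1)
        have "a ! length xs \<in> {0, 1}"
          by (rule words_subset[OF aw nth_mem[OF Suc_lessD[OF len]]])
        moreover have "a ! Suc (length xs) \<in> {0, 1}"
          by (rule words_subset[OF aw nth_mem[OF len]])
        ultimately have "?h (a ! length xs, a ! Suc (length xs)) \<in> ?A"
          by (intro imageI SigmaI)
        then have "a \<in> ?A"
          by (simp only: case_prod_conv a_eq)
        then show False by (rule DiffD2[OF a])
      qed
      then show "F a = 0" unfolding F_def by (simp only: if_False conj_assoc simp_thms mult_zero_right)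
    qed
  qed (rule finite_words)
  also have "\<dots> = (\<Sum>(u, v)\<in>{0, 1} \<times> {0, 1}. F (xs @ u # v # ys))"
    by (subst sum.reindex) (auto simp: inj_on_def intro!: sum.cong)
  also have "\<dots> = (\<Sum>(u, v)\<in>{0, 1} \<times> {0, 1}. g (xs @ u # v # ys) * R_check z (basis [u, v]) [x, y])"
    using w by (intro sum.cong) (auto simp: F_def p nth_append)
  also have "\<dots> = braid_op (\<lambda>c. c) z (Suc (length ys)) g ?b"
    using xy by (elim insertE emptyE) (simp_all add: sum_pairs R_check_entry braid_op_split, simp_all add: basis_def)
  finally show ?thesis .
qed

lemma bold_s_split:
  assumes "xs @ x # y # ys \<in> words n" "i = Suc (length ys)"
  shows "bold_s n i f (xs @ x # y # ys) =
     braid_op (perm_laurent (adj i)) (\<alpha> i) i f (xs @ x # y # ys)"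
proof -
  have "n - i = Suc (length xs)"
    using assms by (auto simp: words_def)
  then show ?thesis
    using assms unfolding bold_s_def by (simp add: R_check_at_split braid_op_split)
qed

lemma bold_s_split_if:
  assumes "xs @ x # y # ys \<in> words n" "i = Suc (length ys)"
  shows "bold_s n i f (xs @ x # y # ys) =
    (if x = 0 \<and> y = 1 then \<alpha> i * perm_laurent (adj i) (f (xs @ 0 # 1 # ys))
     else if x = 1 \<and> y = 0 then perm_laurent (adj i) (f (xs @ 1 # 0 # ys)) +
       (1 - \<alpha> i) * perm_laurent (adj i) (f (xs @ 0 # 1 # ys))
     else perm_laurent (adj i) (f (xs @ x # y # ys)))"
  using assms by (simp only: bold_s_split braid_op_split)

lemma bold_s_word:
  assumes "b \<in> words n" "1 \<le> i" "i < n"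
  shows "bold_s n i f b = braid_op (perm_laurent (adj i)) (\<alpha> i) i f b"
proof -
  have "i < length b" using assms by (simp add: words_def)
  then show ?thesis using assms bold_s_split split_at_two by metis
qed

lemma bold_s_nonword: "b \<notin> words n \<Longrightarrow> bold_s n i f b = 0"
  by (simp add: bold_s_def R_check_at_def lin_def)

section \<open>Coxeter relations for the operators \<open>bold_s\<close>\<close>

lemmas perm_laurent_adj_simps =
  perm_laurent_0[OF bij_transpose] perm_laurent_1[OF bij_transpose]
  perm_laurent_add[OF bij_transpose] perm_laurent_diff[OF bij_transpose]
  perm_laurent_mult[OF bij_transpose] perm_laurent_eps[OF bij_transpose]
  perm_laurent_eps_inv[OF bij_transpose]

lemma perm_laurent_adj_square: "perm_laurent (adj i) (perm_laurent (adj i) \<chi>) = \<chi>"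
  by (simp add: perm_laurent_comp bij_transpose perm_laurent_id)

lemma perm_laurent_adj_braid:
  "perm_laurent (adj i) (perm_laurent (adj (Suc i)) (perm_laurent (adj i) \<chi>)) =
   perm_laurent (adj (Suc i)) (perm_laurent (adj i) (perm_laurent (adj (Suc i)) \<chi>))"
  using adj_braid[of i] by (simp add: perm_laurent_comp bij_comp del: comp_apply)

lemma perm_laurent_adj_commute:
  assumes "Suc i < j"
  shows "perm_laurent (adj i) (perm_laurent (adj j) \<chi>) = perm_laurent (adj j) (perm_laurent (adj i) \<chi>)"
  using adj_commute[OF assms] by (simp add: perm_laurent_comp bij_transpose)

text \<open>The twist inverts \<alpha>, and on the pair 10 the two mixed terms cancel: with
  \<open>a\<close> for \<alpha>, \<open>(1 - 1/a) + (1 - a)/a = 0\<close>. Membership in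
  \<open>V n\<close> is used at non-words, where the left side is zero.\<close>

lemma bold_s_square:
  assumes "1 \<le> i" "i < n" "f \<in> V n"
  shows "bold_s n i (bold_s n i f) = f"
proof
  fix b
  show "bold_s n i (bold_s n i f) b = f b"
  proof (cases "b \<in> words n")
    case False
    then show ?thesis using assms by (simp add: bold_s_nonword V_def)
  next
    case True
    then have "i < length b" using assms by (simp add: words_def)
    then obtain xs x y ys where b: "b = xs @ x # y # ys" "i = Suc (length ys)"
      using split_at_two[OF assms(1)] by metis
    have w: "xs @ u # v # ys \<in> words n" if "u \<in> {0, 1}" "v \<in> {0, 1}" for u v
      using that True b by (auto simp: words_def)
    have xy: "x \<in> {0, 1}" "y \<in> {0, 1}" using True b by (auto simp: words_def)
    then consider "x = 0" "y = 1" | "x = 1" "y = 0" | "x = y" "x = 0" | "x = y" "x = 1" by auto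
    then show ?thesis
      unfolding b(1)
      by cases (simp_all add: w b(2) bold_s_split braid_op_split perm_laurent_adj_simps
          perm_laurent_adj_square \<alpha>_def algebra_simps eps_eps_inv)
  qed
qed

text \<open>The two pairs of letters are disjoint, and each transposition fixes the argument of the
  other R-matrix.\<close>

lemma bold_s_commute:
  assumes "1 \<le> i" "Suc i < j" "j < n"
  shows "bold_s n i (bold_s n j f) = bold_s n j (bold_s n i f)"
proof
  fix b
  show "bold_s n i (bold_s n j f) b = bold_s n j (bold_s n i f) b"
  proof (cases "b \<in> words n")
    case False
    then show ?thesis by (simp add: bold_s_nonword)
  next
    case True
    then have jb: "1 \<le> j" "j < length b" using assms by (auto simp: words_def)
    obtain xs x y zs where b: "b = xs @ x # y # zs" "j = Suc (length zs)"
      using split_at_two[OF jb] by metis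
    have "i < length zs" using assms b by simp
    then obtain ms u v ys where zs: "zs = ms @ u # v # ys" "i = Suc (length ys)"
      using split_at_two[OF assms(1)] by metis
    have w: "xs @ x # y # ms @ u # v # ys \<in> words n" if "x \<in> {0, 1}" "y \<in> {0, 1}" "u \<in> {0, 1}" "v \<in> {0, 1}" for x y u v
      using that True b zs by (auto simp: words_def)
    have xy: "x \<in> {0, 1}" "y \<in> {0, 1}" "u \<in> {0, 1}" "v \<in> {0, 1}" using True b zs by (auto simp: words_def)
    have j: "j = Suc (length (ms @ u # v # ys))" for u v :: nat
      using b(2) zs(1) by simp
    \<comment> \<open>The letters of the other pair stay schematic, because unfolding the outer
      operator evaluates the inner one at words with changed letters.\<close>
    note J = bold_s_split_if[of xs _ _ "ms @ u # v # ys" n j for u v, OF w j]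
    note I = bold_s_split_if[of "xs @ x # y # ms" _ _ ys n i for x y, unfolded append_assoc append_Cons, OF w zs(2)]
    have a: "perm_laurent (adj i) (\<alpha> j) = \<alpha> j" "perm_laurent (adj j) (\<alpha> i) = \<alpha> i"
      using assms by (simp_all add: \<alpha>_def perm_laurent_adj_simps Transposition.transpose_def)
    have "bold_s n i (bold_s n j f) (xs @ x # y # ms @ u # v # ys) = bold_s n j (bold_s n i f) (xs @ x # y # ms @ u # v # ys)"
      using xy
      by (elim insertE emptyE;
          simp only: I J insert_iff simp_thms zero_neq_one one_neq_zero if_True if_False;
          simp only: a perm_laurent_adj_simps perm_laurent_adj_commute[OF assms(2)];
          simp add: algebra_simps)
    then show ?thesis by (simp add: b zs)
  qed
qed

text \<open>This is the Yang-Baxter equation. The twists turn the three arguments into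
  \<open>a\<close>, \<open>a * b\<close>, \<open>b\<close> on one side and \<open>b\<close>,
  \<open>a * b\<close>, \<open>a\<close> on the other, where \<open>a\<close> and \<open>b\<close>
  are the values of \<alpha> at \<open>i\<close> and \<open>Suc i\<close>. It is checked on the
  eight triples of letters.\<close>

lemma bold_s_braid:
  assumes "1 \<le> i" "Suc i < n"
  shows "bold_s n i (bold_s n (Suc i) (bold_s n i f)) = bold_s n (Suc i) (bold_s n i (bold_s n (Suc i) f))"
proof
  fix b
  show "bold_s n i (bold_s n (Suc i) (bold_s n i f)) b = bold_s n (Suc i) (bold_s n i (bold_s n (Suc i) f)) b"
  proof (cases "b \<in> words n")
    case False
    then show ?thesis by (simp add: bold_s_nonword)
  next
    case True
    then have jb: "1 \<le> Suc i" "Suc i < length b" using assms by (auto simp: words_def)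
    obtain xs x y zs where b: "b = xs @ x # y # zs" "Suc i = Suc (length zs)"
      using split_at_two[OF jb] by metis
    then obtain v ys where zs: "zs = v # ys" using assms by (cases zs) auto
    have w: "xs @ x # y # v # ys \<in> words n" if "x \<in> {0, 1}" "y \<in> {0, 1}" "v \<in> {0, 1}" for x y v
      using that True b zs by (auto simp: words_def)
    have xy: "x \<in> {0, 1}" "y \<in> {0, 1}" "v \<in> {0, 1}" using True b zs by (auto simp: words_def)
    have i: "i = Suc (length ys)" using b(2) zs by simp
    then have j: "Suc i = Suc (length (v # ys))" for v :: nat by simp
    note J = bold_s_split_if[of xs _ _ "v # ys" n "Suc i" for v, OF w j]
    note I = bold_s_split_if[of "xs @ [x]" _ _ ys n i for x, unfolded append_assoc append_Cons append_Nil, OF w i]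
    have e': "eps k * (eps_inv k * c) = c" for k c
      by (simp add: eps_eps_inv flip: mult.assoc)
    have a: "perm_laurent (adj i) (\<alpha> i) = eps (Suc i) * eps_inv i"
      "perm_laurent (adj (Suc i)) (\<alpha> (Suc i)) = eps (Suc (Suc i)) * eps_inv (Suc i)"
      "perm_laurent (adj (Suc i)) (\<alpha> i) = eps i * eps_inv (Suc (Suc i))"
      "perm_laurent (adj i) (\<alpha> (Suc i)) = eps i * eps_inv (Suc (Suc i))"
      by (simp_all add: \<alpha>_def perm_laurent_adj_simps Transposition.transpose_def)
    have "bold_s n i (bold_s n (Suc i) (bold_s n i f)) (xs @ x # y # v # ys) =
       bold_s n (Suc i) (bold_s n i (bold_s n (Suc i) f)) (xs @ x # y # v # ys)"
      using xy
      by (elim insertE emptyE;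
          simp only: I J insert_iff simp_thms zero_neq_one one_neq_zero if_True if_False;
          simp add: perm_laurent_adj_simps perm_laurent_adj_square perm_laurent_adj_braid
            a \<alpha>_def eps_eps_inv e' algebra_simps)
    then show ?thesis by (simp add: b zs)
  qed
qed

section \<open>Monodromy operators\<close>

text \<open>The variable attached to the first letter of a word has the length of the word as its index, so
  the recursion does not have to carry the number of tensor factors.\<close>

fun transfer :: "(nat \<Rightarrow> nat \<Rightarrow> nat \<Rightarrow> 'a mat2) \<Rightarrow> nat \<Rightarrow> nat \<Rightarrow> 'a::comm_ring_1 vec \<Rightarrow> 'a vec" where
  "transfer L i j f [] = (if i = j then f [] else 0)"
| "transfer L i j f (b # bs) =
     (\<Sum>k\<in>{0, 1}. \<Sum>a\<in>{0, 1}. L (Suc (length bs)) k j b a * transfer L i k (\<lambda>as. f (a # as)) bs)"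

lemma words_0: "words 0 = {[]}"
  by (auto simp: words_def)

lemma Cons_in_words: "c # b \<in> words (Suc m) \<longleftrightarrow> c \<in> {0, 1} \<and> b \<in> words m"
  by (auto simp: words_def)

lemma sum_words_Suc:
  "(\<Sum>w\<in>words (Suc m). h w) = (\<Sum>a\<in>{0, 1}. \<Sum>w\<in>words m. h (a # w))"
proof -
  have "words (Suc m) = (\<lambda>(a, w). a # w) ` ({0, 1} \<times> words m)"
    by (auto simp: words_def length_Suc_conv image_iff)
  then have "(\<Sum>w\<in>words (Suc m). h w) = (\<Sum>(a, w)\<in>{0, 1} \<times> words m. h (a # w))"
    by (simp add: sum.reindex inj_on_def case_prod_unfold)
  then show ?thesis
    by (simp only: sum.cartesian_product)
qed

lemma tensor_op_Cons:
  assumes "c \<in> {0, 1}"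
  shows "tensor_op (Suc m) M f (c # b) =
    (\<Sum>a\<in>{0, 1}. M 0 c a * tensor_op m (\<lambda>q. M (Suc q)) (\<lambda>as. f (a # as)) b)"
proof -
  have "tensor_op (Suc m) M f (c # b) = (\<Sum>a\<in>{0, 1}. \<Sum>w\<in>words m. f (a # w) *
      (if b \<in> words m then M 0 c a * (\<Prod>q<m. M (Suc q) (b ! q) (w ! q)) else 0))"
    unfolding tensor_op_def lin_def sum_words_Suc Cons_in_words prod.lessThan_Suc_shift
      nth_Cons_0 nth_Cons_Suc
    using assms by simp
  also have "\<dots> = (\<Sum>a\<in>{0, 1}. M 0 c a * tensor_op m (\<lambda>q. M (Suc q)) (\<lambda>as. f (a # as)) b)"
    unfolding tensor_op_def lin_def sum_distrib_left by (intro sum.cong refl) (simp add: ac_simps)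
  finally show ?thesis .
qed

text \<open>The summation index \<open>k\<close> is the head of the list of inner auxiliary indices;
  this list is nonempty because at least two factors are present.\<close>

lemma monodromy_Cons:
  assumes "c \<in> {0, 1}" "0 < m"
  shows "monodromy L (Suc m) i j f (c # b) =
    (\<Sum>k\<in>{0, 1}. \<Sum>a\<in>{0, 1}. L (Suc m) k j c a * monodromy L m i k (\<lambda>as. f (a # as)) b)"
proof -
  obtain p where m: "m = Suc p" using assms(2) by (cases m) auto
  have "monodromy L (Suc m) i j f (c # b) = (\<Sum>k\<in>{0, 1}. \<Sum>ks\<in>words p. \<Sum>a\<in>{0, 1}. L (Suc m) k j c a *
      tensor_op m (\<lambda>q. L (m - q) ((k # ks @ [i]) ! (q + 1)) ((k # ks @ [i]) ! q)) (\<lambda>as. f (a # as)) b)"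
    unfolding monodromy_def m diff_Suc_1 sum_words_Suc tensor_op_Cons[OF assms(1)] by simp
  also have "\<dots> = (\<Sum>k\<in>{0, 1}. \<Sum>a\<in>{0, 1}. L (Suc m) k j c a * monodromy L m i k (\<lambda>as. f (a # as)) b)"
    unfolding monodromy_def m diff_Suc_1 sum_distrib_left by (intro sum.cong refl sum.swap)
  finally show ?thesis .
qed

lemma monodromy_1:
  assumes "c \<in> {0, 1}"
  shows "monodromy L 1 i j f [c] = (\<Sum>a\<in>{0, 1}. L 1 i j c a * f [a])"
  using tensor_op_Cons[OF assms, of 0 "\<lambda>q. L (1 - q) ([j, i] ! (q + 1)) ([j, i] ! q)" f "[]"]
  by (simp add: monodromy_def words_0 tensor_op_def lin_def One_nat_def)

text \<open>At length zero the two sides differ: \<open>transfer\<close> contains a Kronecker delta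
  of the auxiliary indices, \<open>monodromy\<close> does not. The identity therefore starts with
  one-letter words, where the delta selects \<open>k = i\<close> in the sum and \<open>i\<close> has
  to be 0 or 1.\<close>

lemma monodromy_word:
  assumes "b \<in> words n" "1 \<le> n" "i \<in> {0, 1}"
  shows "monodromy L n i j f b = transfer L i j f b"
  using assms(1,2)
proof (induction b arbitrary: n j f)
  case Nil
  then show ?case by (simp add: words_def)
next
  case (Cons c b)
  then obtain m where n: "n = Suc m" "c \<in> {0, 1}" "b \<in> words m" "length b = m"
    by (cases n) (auto simp: words_def)
  show ?case
  proof (cases "m = 0")
    case True
    then show ?thesis using n assms(3) by (auto simp: monodromy_1 simp flip: One_nat_def)
  next
    case False
    then show ?thesis
      unfolding n(1) using n Cons.IH[OF n(3)] by (simp add: monodromy_Cons del: sum.insert)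
  qed
qed

lemma monodromy_nonword: "b \<notin> words n \<Longrightarrow> monodromy L n i j f b = 0"
  by (simp add: monodromy_def tensor_op_def lin_def)

lemma transfer_cong:
  "(\<And>as. as \<in> words (length b) \<Longrightarrow> f as = g as) \<Longrightarrow> transfer L i j f b = transfer L i j g b"
proof (induction b arbitrary: f g j)
  case (Cons c b)
  have "transfer L i k (\<lambda>as. f (a # as)) b = transfer L i k (\<lambda>as. g (a # as)) b" if "a \<in> {0, 1}" for a k
    by (rule Cons.IH) (use that in \<open>auto simp: Cons.prems Cons_in_words\<close>)
  then show ?case
    unfolding transfer.simps by (intro sum.cong refl) (simp only:)
qed (simp add: words_0)

lemma transfer_add: "transfer L i j (\<lambda>as. f as + g as) b = transfer L i j f b + transfer L i j g b"
  by (induction b arbitrary: f g j) (simp_all add: distrib_left sum.distrib del: sum.insert)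

lemma transfer_scale: "transfer L i j (\<lambda>as. c * f as) b = c * transfer L i j f b"
  by (induction b arbitrary: f j) (simp_all add: sum_distrib_left mult.left_commute del: sum.insert)

section \<open>Exchange of adjacent local operators by the R-matrix\<close>

definition R_local :: "'a::comm_ring_1 \<Rightarrow> (nat \<Rightarrow> nat \<Rightarrow> 'a) \<Rightarrow> nat \<Rightarrow> nat \<Rightarrow> 'a" where
  "R_local z G x y = (if x = 0 \<and> y = 1 then z * G 0 1
     else if x = 1 \<and> y = 0 then G 1 0 + (1 - z) * G 0 1 else G x y)"

text \<open>The contraction of two neighbouring local operators along the auxiliary space.
  \<open>F l a c\<close> abstracts the rest of the chain entered in auxiliary state
  \<open>l\<close>, so an identity for all \<open>F\<close> is an identity of operators.\<close>

definition two_site ::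
  "(nat \<Rightarrow> nat \<Rightarrow> 'a mat2) \<Rightarrow> (nat \<Rightarrow> nat \<Rightarrow> 'a mat2) \<Rightarrow> nat \<Rightarrow> (nat \<Rightarrow> nat \<Rightarrow> nat \<Rightarrow> 'a) \<Rightarrow> nat \<Rightarrow> nat \<Rightarrow>
     'a::comm_ring_1" where
  "two_site L1 L2 j F x y =
     (\<Sum>k\<in>{0, 1}. \<Sum>a\<in>{0, 1}. L1 k j x a * (\<Sum>l\<in>{0, 1}. \<Sum>c\<in>{0, 1}. L2 l k y c * F l a c))"

text \<open>The R-matrix acts on the two leading letters and the transfer on the tail, so linearity
  of the latter suffices.\<close>

lemma R_local_transfer:
  "R_local z (\<lambda>u v. transfer L i j (f u v) b) =
   (\<lambda>x y. transfer L i j (\<lambda>as. R_local z (\<lambda>u v. f u v as) x y) b)"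
proof (intro ext)
  fix x y :: nat
  consider "x = 0 \<and> y = 1" | "x = 1 \<and> y = 0" | "\<not> (x = 0 \<and> y = 1)" "\<not> (x = 1 \<and> y = 0)"
    by blast
  then show "R_local z (\<lambda>u v. transfer L i j (f u v) b) x y =
      transfer L i j (\<lambda>as. R_local z (\<lambda>u v. f u v as) x y) b"
  proof cases
    case 1
    then show ?thesis by (simp add: R_local_def transfer_scale)
  next
    case 2
    then show ?thesis by (simp add: R_local_def transfer_add transfer_scale)
  next
    case 3
    show ?thesis unfolding R_local_def if_not_P[OF 3(1)] if_not_P[OF 3(2)] by (rule refl)
  qed
qed

lemma transfer_Cons_Cons:
  "transfer L i j f (x # y # ys) = two_site (L (Suc (Suc (length ys)))) (L (Suc (length ys))) j
     (\<lambda>l a c. transfer L i l (\<lambda>as. f (a # c # as)) ys) x y"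
  by (simp add: two_site_def del: sum.insert)

lemma braid_op_R_local:
  assumes "i = Suc (length ys)"
  shows "braid_op \<sigma> z i f (xs @ x # y # ys) = R_local z (\<lambda>u v. \<sigma> (f (xs @ u # v # ys))) x y"
  using assms by (simp add: braid_op_split R_local_def)

text \<open>Positions are counted from the end, so a letter put in front does not shift
  them.\<close>

lemma braid_op_Cons:
  assumes "1 \<le> i" "i < length b"
  shows "braid_op \<sigma> z i f (c # b) = braid_op \<sigma> z i (\<lambda>as. f (c # as)) b"
proof -
  obtain xs x y ys where b: "b = xs @ x # y # ys" "i = Suc (length ys)"
    using split_at_two[OF assms] .
  then show ?thesis
    using braid_op_R_local[of i ys \<sigma> z f "c # xs" x y] by (simp add: braid_op_R_local)
qed

text \<open>Replacing two letters by 0 and 1 keeps a word a word. This is needed because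
  \<open>monodromy\<close> and \<open>transfer\<close> are identified only on words.\<close>

lemma braid_op_cong_words:
  assumes "\<And>as. as \<in> words n \<Longrightarrow> f as = g as" "b \<in> words n" "1 \<le> i" "i < n"
  shows "braid_op \<sigma> z i f b = braid_op \<sigma> z i g b"
proof -
  have "i < length b" using assms by (simp add: words_def)
  then obtain xs x y ys where b: "b = xs @ x # y # ys" "i = Suc (length ys)"
    using split_at_two[OF assms(3)] by metis
  have "f (xs @ u # v # ys) = g (xs @ u # v # ys)" if "u \<in> {0, 1}" "v \<in> {0, 1}" for u v
    using assms(1,2) that b by (auto simp: words_def)
  note fg = this[of 0 0] this[of 0 1] this[of 1 0] this[of 1 1]
  have "x \<in> {0, 1}" "y \<in> {0, 1}" using assms(2) b by (auto simp: words_def)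
  then show ?thesis
    unfolding b(1) braid_op_split[OF b(2)] using fg by (elim insertE emptyE; simp)
qed

lemma braid_op_cong:
  "(\<And>as. length as = length b \<Longrightarrow> f as = g as) \<Longrightarrow> braid_op \<sigma> z i f b = braid_op \<sigma> z i g b"
  by (simp add: braid_op_def Let_def)

text \<open>The assumptions separate two effects: the twist renames the variable of each local
  operator, and the R-matrix exchanges the order of the two operators concerned. Both spectral
  families are instances.\<close>

locale rll =
  fixes \<sigma> :: "'a::comm_ring_1 \<Rightarrow> 'a" and z :: 'a and i :: nat
    and L :: "nat \<Rightarrow> nat \<Rightarrow> nat \<Rightarrow> 'a mat2"
  assumes \<sigma>_add: "\<sigma> (x + y) = \<sigma> x + \<sigma> y"
    and \<sigma>_mult: "\<sigma> (x * y) = \<sigma> x * \<sigma> y"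
    and \<sigma>_0: "\<sigma> 0 = 0"
    and \<sigma>_L: "\<sigma> (L m k j r c) = L (adj i m) k j r c"
    and RLL: "j \<in> {0, 1} \<Longrightarrow> u \<in> {0, 1} \<Longrightarrow> v \<in> {0, 1} \<Longrightarrow>
      R_local z (two_site (L i) (L (Suc i)) j F) u v =
      two_site (L (Suc i)) (L i) j (\<lambda>l. R_local z (F l)) u v"
begin

lemma \<sigma>_sum: "\<sigma> (\<Sum>k\<in>{0, 1}. g k) = (\<Sum>k\<in>{0, 1::nat}. \<sigma> (g k))"
  by (simp add: \<sigma>_add)

text \<open>Local operators along the tail have indices at most its length, below \<open>i\<close>,
  so the twist fixes all of them.\<close>

lemma \<sigma>_transfer:
  assumes "length b < i"
  shows "\<sigma> (transfer L r j f b) = transfer L r j (\<lambda>as. \<sigma> (f as)) b"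
  using assms
proof (induction b arbitrary: f j)
  case (Cons c b)
  then have "adj i (Suc (length b)) = Suc (length b)"
    by (simp add: Transposition.transpose_def)
  with Cons show ?case
    by (simp add: \<sigma>_sum \<sigma>_mult \<sigma>_L del: sum.insert)
qed (simp add: \<sigma>_0)

lemma \<sigma>_two_site:
  "\<sigma> (two_site (L m) (L m') j F x y) = two_site (L (adj i m)) (L (adj i m')) j (\<lambda>l a c. \<sigma> (F l a c)) x y"
  by (simp add: two_site_def \<sigma>_sum \<sigma>_mult \<sigma>_L del: sum.insert)

lemma braid_op_sum:
  "braid_op \<sigma> z i (\<lambda>as. \<Sum>k\<in>{0, 1}. g k as) b = (\<Sum>k\<in>{0, 1::nat}. braid_op \<sigma> z i (g k) b)"
  by (simp add: braid_op_def Let_def \<sigma>_add algebra_simps)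

lemma braid_op_scale:
  "\<sigma> c = c \<Longrightarrow> braid_op \<sigma> z i (\<lambda>as. c * g as) b = c * braid_op \<sigma> z i g b"
  by (simp add: braid_op_def Let_def \<sigma>_mult algebra_simps)

theorem braid_op_transfer:
  assumes "b \<in> words n" "1 \<le> i" "i < n" "j \<in> {0, 1}"
  shows "braid_op \<sigma> z i (transfer L r j f) b = transfer L r j (braid_op \<sigma> z i f) b"
  using assms(1,3,4)
proof (induction b arbitrary: n j f)
  case Nil
  then show ?case by (simp add: words_def)
next
  case (Cons c b)
  then obtain m where n: "n = Suc m" "b \<in> words m" "length b = m" "c \<in> {0, 1}"
    by (cases n) (auto simp: words_def)
  show ?case
  proof (cases "i < m")
    case True
    \<comment> \<open>The operator at the leading letter has index \<open>Suc m\<close>, which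
      exceeds \<open>Suc i\<close>, so it passes through the twisted operator unchanged.\<close>
    then have fixed: "\<sigma> (L (Suc (length b)) k j c a) = L (Suc (length b)) k j c a" for k a
      using n(3) by (simp add: \<sigma>_L Transposition.transpose_def)
    have "braid_op \<sigma> z i (transfer L r j f) (c # b) =
        braid_op \<sigma> z i (\<lambda>as. \<Sum>k\<in>{0, 1}. \<Sum>a\<in>{0, 1}. L (Suc (length b)) k j c a * transfer L r k (\<lambda>as. f (a # as)) as) b"
      using True n(3) assms(2) by (simp add: braid_op_Cons del: sum.insert cong: braid_op_cong)
    also have "\<dots> = (\<Sum>k\<in>{0, 1}. \<Sum>a\<in>{0, 1}. L (Suc (length b)) k j c a *
        transfer L r k (braid_op \<sigma> z i (\<lambda>as. f (a # as))) b)"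
      unfolding braid_op_sum braid_op_scale[OF fixed]
      using Cons.IH[OF n(2) True] by (intro sum.cong refl) simp
    also have "\<dots> = (\<Sum>k\<in>{0, 1}. \<Sum>a\<in>{0, 1}. L (Suc (length b)) k j c a *
        transfer L r k (\<lambda>as. braid_op \<sigma> z i f (a # as)) b)"
      using True n(3) assms(2)
      by (intro sum.cong refl arg_cong2[of _ _ _ _ "(*)"] transfer_cong) (simp add: braid_op_Cons words_def)
    finally show ?thesis by (simp del: sum.insert)
  next
    case False
    \<comment> \<open>Now \<open>i = m\<close>: the pair acted upon consists of the two leading
      letters.\<close>
    then obtain y ys where b: "b = y # ys" "i = Suc (length ys)"
      using Cons.prems(2) n(1,3) assms(2) by (cases b) auto
    have y: "y \<in> {0, 1}" using n(2) b(1) by (simp add: words_def)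
    \<comment> \<open>The two leading operators occur with indices \<open>Suc i\<close>,
      \<open>i\<close>; the twist reverses this order, and the RLL relation below restores
      it.\<close>
    have \<sigma>': "\<sigma> (transfer L r j f (u # v # ys)) = two_site (L i) (L (Suc i)) j
        (\<lambda>l a c. transfer L r l (\<lambda>as. \<sigma> (f (a # c # as))) ys) u v" for u v
      unfolding transfer_Cons_Cons b(2)[symmetric] \<sigma>_two_site
      using \<sigma>_transfer[of ys] b(2) by simp
    have tail: "transfer L r l (\<lambda>as. R_local z (\<lambda>u v. \<sigma> (f (u # v # as))) a d) ys =
        transfer L r l (\<lambda>as. braid_op \<sigma> z i f (a # d # as)) ys" for l a d
      by (rule transfer_cong, rule braid_op_R_local[where xs = "[]", simplified, symmetric])
        (simp add: b(2) words_def)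
    have "braid_op \<sigma> z i (transfer L r j f) (c # b) = R_local z (two_site (L i) (L (Suc i)) j
        (\<lambda>l a c. transfer L r l (\<lambda>as. \<sigma> (f (a # c # as))) ys)) c y"
      using braid_op_R_local[OF b(2), of \<sigma> z "transfer L r j f" "[]" c y] b(1) \<sigma>'
      by (simp add: R_local_def)
    also have "\<dots> = two_site (L (Suc i)) (L i) j
        (\<lambda>l a d. transfer L r l (\<lambda>as. R_local z (\<lambda>u v. \<sigma> (f (u # v # as))) a d) ys) c y"
      unfolding RLL[OF Cons.prems(3) n(4) y] R_local_transfer ..
    also have "\<dots> = two_site (L (Suc i)) (L i) j
        (\<lambda>l a d. transfer L r l (\<lambda>as. braid_op \<sigma> z i f (a # d # as)) ys) c y"
      by (simp only: tail)
    also have "\<dots> = transfer L r j (braid_op \<sigma> z i f) (c # b)"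
      by (simp only: b transfer_Cons_Cons)
    finally show ?thesis .
  qed
qed

end

text \<open>In terms of \<open>u = z/\<epsilon>\<close>, respectively \<open>u = z \<epsilon>\<close>, the values of \<open>u\<close> for two
  adjacent variables differ by the factor \<open>\<alpha>\<close>, so that the RLL relation is a polynomial identity in \<open>u\<close> and \<open>\<alpha>\<close>.\<close>

definition t_mat :: "'a::comm_ring_1 \<Rightarrow> nat \<Rightarrow> nat \<Rightarrow> 'a mat2" where
  "t_mat u i j =
     (if (i, j) = (0, 0) then (\<lambda>r c. E 0 0 r c + (1 + u) * E 1 1 r c)
      else if (i, j) = (0, 1) then E 1 0
      else if (i, j) = (1, 0) then (\<lambda>r c. - u * E 0 1 r c)
      else E 1 1)"

definition tt_mat :: "'a::comm_ring_1 \<Rightarrow> nat \<Rightarrow> nat \<Rightarrow> 'a mat2" where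
  "tt_mat u i j =
     (if (i, j) = (0, 0) then (\<lambda>r c. (1 + u) * E 0 0 r c + E 1 1 r c)
      else if (i, j) = (0, 1) then (\<lambda>r c. - u * E 1 0 r c)
      else if (i, j) = (1, 0) then E 0 1
      else E 0 0)"

lemma t_loc_eq_t_mat: "t_loc m = t_mat [:0, eps_inv m:]"
  by (simp add: fun_eq_iff t_loc_def t_mat_def)

lemma tt_loc_eq_tt_mat: "tt_loc m = tt_mat [:0, eps m:]"
  by (simp add: fun_eq_iff tt_loc_def tt_mat_def)

text \<open>Here \<open>z\<close> is the argument of the R-matrix, while the spectral parameter is
  absorbed in \<open>u\<close>. Each of the eight choices of \<open>j\<close>, \<open>x\<close>,
  \<open>y\<close> gives an identity linear in the values of \<open>F\<close>.\<close>

lemma t_mat_RLL: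
  assumes "j \<in> {0, 1}" "x \<in> {0, 1}" "y \<in> {0, 1}"
  shows "R_local z (two_site (t_mat u) (t_mat (z * u)) j F) x y =
     two_site (t_mat (z * u)) (t_mat u) j (\<lambda>l. R_local z (F l)) x y"
  using assms
  by (elim insertE emptyE; simp add: two_site_def R_local_def t_mat_def E_def; simp add: algebra_simps)

lemma tt_mat_RLL:
  assumes "j \<in> {0, 1}" "x \<in> {0, 1}" "y \<in> {0, 1}"
  shows "R_local z (two_site (tt_mat (z * u)) (tt_mat u) j F) x y =
     two_site (tt_mat u) (tt_mat (z * u)) j (\<lambda>l. R_local z (F l)) x y"
  using assms
  by (elim insertE emptyE; simp add: two_site_def R_local_def tt_mat_def E_def; simp add: algebra_simps)

section \<open>The action of the symmetric group\<close>

lemma perm_laurent_adj_in_Rep_T: "1 \<le> i \<Longrightarrow> i < n \<Longrightarrow> \<chi> \<in> Rep_T n \<Longrightarrow> perm_laurent (adj i) \<chi> \<in> Rep_T n"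
  by (intro perm_laurent_in_Rep_T adj_permutes bij_transpose)

lemma bold_s_in_V:
  assumes "1 \<le> i" "i < n" "f \<in> V n"
  shows "bold_s n i f \<in> V n"
proof -
  have "bold_s n i f b \<in> Rep_T n" for b
  proof (cases "b \<in> words n")
    case True
    then show ?thesis
      using assms \<alpha>_in_Rep_T[OF assms(1,2)]
      by (auto simp: bold_s_word braid_op_def Let_def V_def
          intro!: Rep_T_add Rep_T_mult Rep_T_diff Rep_T_1 perm_laurent_adj_in_Rep_T)
  qed (simp add: bold_s_nonword Rep_T_0)
  then show ?thesis by (simp add: V_def bold_s_nonword)
qed

lemma bold_s_0:
  assumes "1 \<le> i" "i < n"
  shows "bold_s n i (\<lambda>_. 0) = (\<lambda>_. 0)"
proof
  fix b
  show "bold_s n i (\<lambda>_. 0) b = 0"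
    using assms by (cases "b \<in> words n")
      (simp_all add: bold_s_nonword bold_s_word braid_op_def Let_def perm_laurent_adj_simps)
qed

lemma BijGroup_compose_eq:
  assumes "restrict g S \<in> Bij S" "restrict h S \<in> Bij S" "\<And>x. x \<in> S \<Longrightarrow> h x \<in> S"
  shows "restrict g S \<otimes>\<^bsub>BijGroup S\<^esub> restrict h S = restrict (\<lambda>x. g (h x)) S"
  using assms by (auto simp: BijGroup_def compose_def fun_eq_iff)

text \<open>Being an involution, each operator is a bijection of \<open>V n\<close>; relations
  between operators then become relations in the group of bijections.\<close>

lemma coxeter_tuple_bold_s: "coxeter_tuple (BijGroup (V n)) n (\<lambda>i. restrict (bold_s n i) (V n))"
proof -
  have bij: "restrict (bold_s n i) (V n) \<in> Bij (V n)" if "1 \<le> i" "i < n" for i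
  proof -
    have "bij_betw (bold_s n i) (V n) (V n)"
      using that by (intro bij_betwI[where g = "bold_s n i"]) (auto simp: bold_s_in_V bold_s_square)
    then show ?thesis by (simp add: Bij_def bij_betw_restrict_eq)
  qed
  have comp: "restrict (bold_s n i) (V n) \<otimes>\<^bsub>BijGroup (V n)\<^esub> restrict (bold_s n j) (V n) =
      restrict (\<lambda>f. bold_s n i (bold_s n j f)) (V n)" if "1 \<le> i" "i < n" "1 \<le> j" "j < n" for i j
    using that by (intro BijGroup_compose_eq bij bold_s_in_V)
  \<comment> \<open>The braid relation involves triple products, for which the inner composite must
    itself be known to be a bijection; closure of the group provides this.\<close>
  have comp3: "restrict (bold_s n k) (V n) \<otimes>\<^bsub>BijGroup (V n)\<^esub> restrict (\<lambda>f. bold_s n i (bold_s n j f)) (V n) =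
      restrict (\<lambda>f. bold_s n k (bold_s n i (bold_s n j f))) (V n)"
    if "1 \<le> i" "i < n" "1 \<le> j" "j < n" "1 \<le> k" "k < n" for i j k
  proof (intro BijGroup_compose_eq bij that bold_s_in_V)
    have "restrict (bold_s n i) (V n) \<otimes>\<^bsub>BijGroup (V n)\<^esub> restrict (bold_s n j) (V n) \<in> carrier (BijGroup (V n))"
      using that bij by (intro monoid.m_closed[OF group.is_monoid[OF group_BijGroup]]) (auto simp: BijGroup_def)
    then show "restrict (\<lambda>f. bold_s n i (bold_s n j f)) (V n) \<in> Bij (V n)"
      by (simp only: comp[OF that(1-4)]) (simp add: BijGroup_def)
  qed
  show ?thesis
    unfolding coxeter_tuple_def
  proof (intro conjI ballI allI impI)
    fix i assume "i \<in> {1..<n}"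
    then show "restrict (bold_s n i) (V n) \<in> carrier (BijGroup (V n))"
      using bij by (simp add: BijGroup_def)
  next
    fix i assume "i \<in> {1..<n}"
    then have i: "1 \<le> i" "i < n" by auto
    show "restrict (bold_s n i) (V n) \<otimes>\<^bsub>BijGroup (V n)\<^esub> restrict (bold_s n i) (V n) = \<one>\<^bsub>BijGroup (V n)\<^esub>"
      unfolding comp[OF i i] by (simp add: BijGroup_def bold_s_square[OF i] cong: restrict_cong)
  next
    fix i assume "1 \<le> i" "Suc i < n"
    then show "restrict (bold_s n i) (V n) \<otimes>\<^bsub>BijGroup (V n)\<^esub>
        (restrict (bold_s n (Suc i)) (V n) \<otimes>\<^bsub>BijGroup (V n)\<^esub> restrict (bold_s n i) (V n)) =
      restrict (bold_s n (Suc i)) (V n) \<otimes>\<^bsub>BijGroup (V n)\<^esub>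
        (restrict (bold_s n i) (V n) \<otimes>\<^bsub>BijGroup (V n)\<^esub> restrict (bold_s n (Suc i)) (V n))"
      by (simp add: comp comp3 bold_s_braid)
  next
    fix i j assume ij: "1 \<le> i" "j < n" "Suc i < j"
    then show "restrict (bold_s n i) (V n) \<otimes>\<^bsub>BijGroup (V n)\<^esub> restrict (bold_s n j) (V n) =
      restrict (bold_s n j) (V n) \<otimes>\<^bsub>BijGroup (V n)\<^esub> restrict (bold_s n i) (V n)"
      by (simp add: comp bold_s_commute[OF ij(1,3,2)])
  qed
qed

lemma R_action_exists: "\<exists>\<rho>. R_action n \<rho>"
proof -
  obtain \<rho> where "\<rho> \<in> hom (sym_group n) (BijGroup (V n))"
    "\<forall>i\<in>{1..<n}. \<rho> (adj i) = restrict (bold_s n i) (V n)"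
    using group.coxeter_tuple_hom_exists[OF group_BijGroup coxeter_tuple_bold_s] by blast
  then show ?thesis
    unfolding R_action_def group_action_def group_hom_def group_hom_axioms_def
    using sym_group_is_group group_BijGroup by blast
qed

section \<open>Reduction of an arbitrary action to generators\<close>

lemma R_action_id:
  assumes "R_action n \<rho>" "f \<in> V n"
  shows "\<rho> id f = f"
proof -
  interpret group_action "sym_group n" "V n" \<rho>
    using assms(1) by (simp add: R_action_def)
  show ?thesis
    using id_eq_one assms(2) by (metis restrict_apply' sym_group_one)
qed

lemma R_action_in_V:
  assumes "R_action n \<rho>" "w permutes {1..n}" "f \<in> V n"
  shows "\<rho> w f \<in> V n"
proof -
  interpret group_action "sym_group n" "V n" \<rho>
    using assms(1) by (simp add: R_action_def)
  show ?thesis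
    using surj_prop[of w] assms by (auto simp: sym_group_carrier)
qed

lemma R_action_adj:
  assumes "R_action n \<rho>" "1 \<le> i" "i < n" "w permutes {1..n}" "f \<in> V n"
  shows "\<rho> (adj i \<circ> w) f = bold_s n i (\<rho> w f)"
proof -
  interpret group_action "sym_group n" "V n" \<rho>
    using assms(1) by (simp add: R_action_def)
  have "\<rho> (adj i \<circ> w) f = \<rho> (adj i) (\<rho> w f)"
    using composition_rule[of f "adj i" w] assms adj_permutes[of i n]
    by (simp only: sym_group_carrier sym_group_mult)
  also have "\<dots> = bold_s n i (\<rho> w f)"
    using assms R_action_in_V[OF assms(1,4,5)] by (simp add: R_action_def)
  finally show ?thesis .
qed

text \<open>The action is by mere bijections, so fixing zero has to be inherited from the
  generators. It is what makes the coefficientwise extension \<open>ext_z\<close>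
  computable.\<close>

lemma R_action_0:
  assumes "R_action n \<rho>" "w permutes {1..n}"
  shows "\<rho> w (\<lambda>_. 0) = (\<lambda>_. 0)"
  using assms(2)
proof (induction w rule: permutes_adj_induct)
  case id
  have "\<rho> id (\<lambda>_. 0) = (\<lambda>_. 0)"
    by (rule R_action_id[OF assms(1)]) (simp add: V_def Rep_T_0)
  then show ?case by (simp add: id_def)
next
  case (adj i w)
  have "\<rho> (adj i \<circ> w) (\<lambda>_. 0) = (\<lambda>_. 0)"
    using R_action_adj[OF assms(1) adj(1-3), of "\<lambda>_. 0"] adj bold_s_0
    by (simp add: V_def Rep_T_0)
  then show ?case by (simp add: o_def)
qed

section \<open>Explicit formula on basis vectors\<close>

lemma bold_s_basis:
  assumes w: "us @ u # v # vs \<in> words n" and i: "i = Suc (length vs)"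
  shows "bold_s n i (\<lambda>a. \<chi> * basis (us @ u # v # vs) a) b =
    (if u < v
     then \<alpha> i * perm_laurent (adj i) \<chi> * basis (us @ u # v # vs) b +
       (1 - \<alpha> i) * perm_laurent (adj i) \<chi> * basis (us @ v # u # vs) b
     else perm_laurent (adj i) \<chi> * basis (us @ u # v # vs) b)"
proof (cases "b \<in> words n")
  case False
  then have "b \<noteq> us @ u # v # vs" "b \<noteq> us @ v # u # vs"
    using w by (auto simp: words_def)
  with False show ?thesis by (simp add: bold_s_nonword basis_def)
next
  case True
  have n: "n = Suc (Suc (length us + length vs))" using w by (simp add: words_def)
  then have "1 \<le> i" "i < length b" using True i by (simp_all add: words_def)
  then obtain xs x y ys where b: "b = xs @ x # y # ys" "i = Suc (length ys)"
    using split_at_two by metis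
  have "length xs = length us"
    using True b i n by (simp add: words_def)
  \<comment> \<open>With equal prefix lengths, equality of words splits into equality of the
    surroundings and of the two letters, so the claim becomes a finite check.\<close>
  then have eq: "xs @ p # q # ys = us @ r # s # vs \<longleftrightarrow> (xs = us \<and> ys = vs) \<and> p = r \<and> q = s" for p q r s
    by auto
  have "x \<in> {0, 1}" "y \<in> {0, 1}" "u \<in> {0, 1}" "v \<in> {0, 1}"
    using True b(1) w by (auto simp: words_def)
  then show ?thesis
    unfolding b(1) bold_s_split_if[OF True[unfolded b(1)] b(2)] basis_def eq
    by (cases "xs = us \<and> ys = vs"; elim insertE emptyE; simp add: perm_laurent_adj_simps)
qed

text \<open>Reversal places the letters numbered \<open>i + 1\<close> and \<open>i\<close> of
  \<open>J\<close> in the two tensor factors, in this order; a descent of \<open>J\<close> is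
  therefore the pair 01, on which the R-matrix is not diagonal after the flip.\<close>

lemma bold_s_pure:
  assumes "i \<in> {1..<n}" "J \<in> words n"
  shows "bold_s n i (pure \<chi> J) =
    (if J ! (i - 1) > J ! i
     then (\<lambda>a. pure (\<alpha> i * perm_laurent (adj i) \<chi>) J a +
       pure ((1 - \<alpha> i) * perm_laurent (adj i) \<chi>) (J[i - 1 := J ! i, i := J ! (i - 1)]) a)
     else pure (perm_laurent (adj i) \<chi>) J)"
proof -
  have "1 \<le> i" "i < length (rev J)" using assms by (auto simp: words_def)
  then obtain us u v vs where c: "rev J = us @ u # v # vs" "i = Suc (length vs)"
    using split_at_two by metis
  have w: "us @ u # v # vs \<in> words n" using assms(2) by (simp add: words_def flip: c(1))
  have J: "J = rev vs @ v # u # rev us"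
    using arg_cong[OF c(1), of rev] by simp
  have "J ! (i - 1) = v" "J ! i = u" "rev (J[i - 1 := u, i := v]) = us @ v # u # vs"
    unfolding J c(2) by (simp_all add: nth_append list_update_append)
  then show ?thesis
    by (simp add: fun_eq_iff pure_def c(1) bold_s_basis[OF w c(2)])
qed

section \<open>Invariance of the weight subspaces\<close>

lemma sum_basis_rev:
  assumes "finite A"
  shows "(\<Sum>J\<in>A. pure (c J) J a) = (if rev a \<in> A then c (rev a) else 0)"
proof -
  have "(\<Sum>J\<in>A. pure (c J) J a) = (\<Sum>J\<in>A. if J = rev a then c J else 0)"
    by (intro sum.cong refl) (auto simp: pure_def basis_def)
  then show ?thesis using assms by simp
qed

lemma rev_in_words: "rev a \<in> words n \<longleftrightarrow> a \<in> words n"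
  by (simp add: words_def)

text \<open>Reversal preserves the number of zeros, so the span becomes a support condition on
  coefficient functions.\<close>

lemma Vk_iff: "f \<in> Vk k n \<longleftrightarrow> f \<in> V n \<and> (\<forall>a. count_list a 0 \<noteq> k \<longrightarrow> f a = 0)"
proof -
  have fin: "finite {J \<in> words n. count_list J 0 = k}"
    by (simp add: finite_words)
  show ?thesis
  proof
    assume "f \<in> Vk k n"
    then show "f \<in> V n \<and> (\<forall>a. count_list a 0 \<noteq> k \<longrightarrow> f a = 0)"
      by (auto simp: Vk_def V_def sum_basis_rev[OF fin] rev_in_words Rep_T_0)
  next
    assume f: "f \<in> V n \<and> (\<forall>a. count_list a 0 \<noteq> k \<longrightarrow> f a = 0)"
    then show "f \<in> Vk k n"
      unfolding Vk_def sum_basis_rev[OF fin]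
      by (auto simp: V_def rev_in_words fun_eq_iff intro!: exI[of _ "\<lambda>J. f (rev J)"])
  qed
qed

text \<open>The value at a word involves only this word and the one with the two letters exchanged,
  and both have equally many zeros.\<close>

lemma bold_s_in_Vk:
  assumes "1 \<le> i" "i < n" "f \<in> Vk k n"
  shows "bold_s n i f \<in> Vk k n"
  unfolding Vk_iff
proof (intro conjI allI impI)
  show "bold_s n i f \<in> V n"
    using assms by (intro bold_s_in_V) (auto simp: Vk_iff)
  fix b :: "nat list" assume b: "count_list b 0 \<noteq> k"
  have f: "f a = 0" if "count_list a 0 \<noteq> k" for a
    using assms(3) that by (simp add: Vk_iff)
  show "bold_s n i f b = 0"
  proof (cases "b \<in> words n")
    case True
    then have "i < length b" using assms(2) by (simp add: words_def)
    then obtain xs x y ys where s: "b = xs @ x # y # ys" "i = Suc (length ys)"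
      using split_at_two[OF assms(1)] by metis
    show ?thesis
      unfolding s(1) bold_s_split_if[OF True[unfolded s(1)] s(2)]
      using b s(1) by (auto simp: f perm_laurent_adj_simps)
  qed (rule bold_s_nonword)
qed

lemma R_action_Vk:
  assumes "R_action n \<rho>" "w permutes {1..n}" "f \<in> Vk k n"
  shows "\<rho> w f \<in> Vk k n"
proof -
  have f: "f \<in> V n" using assms(3) by (simp add: Vk_iff)
  show ?thesis
    using assms(2)
  proof (induction w rule: permutes_adj_induct)
    case id
    show ?case using R_action_id[OF assms(1) f] assms(3) by (simp add: id_def)
  next
    case (adj i w)
    then have "\<rho> (adj i \<circ> w) f \<in> Vk k n"
      using R_action_adj[OF assms(1) adj(1-3) f] bold_s_in_Vk by simp
    then show ?case by (simp add: o_def)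
  qed
qed

section \<open>Commutation with the spectral operators\<close>

abbreviation perm_poly :: "nat \<Rightarrow> laurent poly \<Rightarrow> laurent poly" where
  "perm_poly i \<equiv> map_poly (perm_laurent (adj i))"

lemma coeff_perm_poly: "coeff (perm_poly i p) m = perm_laurent (adj i) (coeff p m)"
  by (simp add: coeff_map_poly perm_laurent_adj_simps)

lemma perm_laurent_sum: "perm_laurent (adj i) (sum g A) = (\<Sum>x\<in>A. perm_laurent (adj i) (g x))"
  using sum_comp_morphism[of "perm_laurent (adj i)" g A] by (simp add: perm_laurent_adj_simps o_def)

lemma perm_poly_add: "perm_poly i (p + q) = perm_poly i p + perm_poly i q"
  by (rule poly_eqI) (simp add: coeff_perm_poly perm_laurent_adj_simps)

lemma perm_poly_mult: "perm_poly i (p * q) = perm_poly i p * perm_poly i q"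
  by (rule poly_eqI) (simp add: coeff_perm_poly coeff_mult perm_laurent_sum perm_laurent_adj_simps)

lemma perm_poly_minus: "perm_poly i (- p) = - perm_poly i p"
  by (rule poly_eqI) (simp add: coeff_perm_poly perm_laurent_minus)

lemma perm_poly_0: "perm_poly i 0 = 0"
  by simp

lemma perm_poly_1: "perm_poly i 1 = 1"
  by (simp add: one_pCons map_poly_pCons perm_laurent_adj_simps)

lemma perm_poly_monomial: "perm_poly i [:0, c:] = [:0, perm_laurent (adj i) c:]"
  by (simp add: map_poly_pCons perm_laurent_adj_simps)

lemma perm_poly_E: "perm_poly i (E a b r c) = E a b r c"
  by (simp add: E_def perm_poly_1)

lemma perm_poly_t_mat: "perm_poly i (t_mat u k j r c) = t_mat (perm_poly i u) k j r c"
  by (simp add: t_mat_def perm_poly_add perm_poly_mult perm_poly_minus perm_poly_1 perm_poly_E)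

lemma perm_poly_tt_mat: "perm_poly i (tt_mat u k j r c) = tt_mat (perm_poly i u) k j r c"
  by (simp add: tt_mat_def perm_poly_add perm_poly_mult perm_poly_minus perm_poly_1 perm_poly_E)

lemma rll_t_loc: "rll (perm_poly i) [:\<alpha> i:] i t_loc"
proof
  \<comment> \<open>The parameter \<open>u\<close> of the RLL identity belongs to the variable with
    index \<open>i\<close>.\<close>
  have "[:\<alpha> i:] * [:0, eps_inv i:] = [:0, eps_inv (Suc i):]"
    using eps_eps_inv[of i] by (simp add: \<alpha>_def ac_simps)
  then show "R_local [:\<alpha> i:] (two_site (t_loc i) (t_loc (Suc i)) j F) u v =
      two_site (t_loc (Suc i)) (t_loc i) j (\<lambda>l. R_local [:\<alpha> i:] (F l)) u v"
    if "j \<in> {0, 1}" "u \<in> {0, 1}" "v \<in> {0, 1}" for j u v F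
    using t_mat_RLL[OF that, of "[:\<alpha> i:]" "[:0, eps_inv i:]" F] by (simp only: t_loc_eq_t_mat)
qed (simp_all only: perm_poly_add perm_poly_mult perm_poly_0 t_loc_eq_t_mat perm_poly_t_mat
    perm_poly_monomial perm_laurent_adj_simps)

lemma rll_tt_loc: "rll (perm_poly i) [:\<alpha> i:] i tt_loc"
proof
  \<comment> \<open>The variables now enter without inversion, so \<open>u\<close> belongs to index
    \<open>Suc i\<close> instead.\<close>
  have "[:\<alpha> i:] * [:0, eps (Suc i):] = [:0, eps i:]"
    using eps_eps_inv[of "Suc i"] by (simp add: \<alpha>_def ac_simps)
  then show "R_local [:\<alpha> i:] (two_site (tt_loc i) (tt_loc (Suc i)) j F) u v =
      two_site (tt_loc (Suc i)) (tt_loc i) j (\<lambda>l. R_local [:\<alpha> i:] (F l)) u v"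
    if "j \<in> {0, 1}" "u \<in> {0, 1}" "v \<in> {0, 1}" for j u v F
    using tt_mat_RLL[OF that, of "[:\<alpha> i:]" "[:0, eps (Suc i):]" F] by (simp only: tt_loc_eq_tt_mat)
qed (simp_all only: perm_poly_add perm_poly_mult perm_poly_0 tt_loc_eq_tt_mat perm_poly_tt_mat
    perm_poly_monomial perm_laurent_adj_simps)

lemma Vz_slice: "f \<in> Vz n \<Longrightarrow> (\<lambda>a. coeff (f a) m) \<in> V n"
  by (simp add: Vz_def V_def)

lemma ext_z_in_Vz:
  assumes "f \<in> Vz n" "A (\<lambda>_. 0) = (\<lambda>_. 0)" "\<And>g. g \<in> V n \<Longrightarrow> A g \<in> V n"
  shows "ext_z A f \<in> Vz n"
proof -
  have "A (\<lambda>a. coeff (f a) m) \<in> V n" for m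
    using assms Vz_slice by blast
  then show ?thesis
    using coeff_ext_z[of f n A, OF assms(1,2)] by (auto simp: Vz_def V_def poly_eq_iff)
qed

text \<open>The argument \<alpha> becomes a constant polynomial, so taking coefficients commutes
  with the formula and the same \<open>braid_op\<close> applies over the polynomial ring.\<close>

lemma ext_z_bold_s:
  assumes "1 \<le> i" "i < n" "f \<in> Vz n"
  shows "ext_z (bold_s n i) f b = (if b \<in> words n then braid_op (perm_poly i) [:\<alpha> i:] i f b else 0)"
proof (rule poly_eqI)
  fix m
  have one: "(1::laurent poly) - [:\<alpha> i:] = [:1 - \<alpha> i:]" by (simp add: one_pCons)
  show "coeff (ext_z (bold_s n i) f b) m =
      coeff (if b \<in> words n then braid_op (perm_poly i) [:\<alpha> i:] i f b else 0) m"
    unfolding coeff_ext_z[of f n "bold_s n i", OF assms(3) bold_s_0[OF assms(1,2)]]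
    using assms(1,2)
    by (simp add: bold_s_word bold_s_nonword braid_op_def Let_def coeff_perm_poly one)
qed

text \<open>Off words both sides vanish; on words \<open>monodromy\<close> is replaced by
  \<open>transfer\<close>. That the image lies in \<open>Vz\<close> is a hypothesis because
  \<open>ext_z\<close> is evaluated on the image as well.\<close>

lemma rll_monodromy:
  assumes "rll (perm_poly i) [:\<alpha> i:] i L" "1 \<le> i" "i < n" "r \<in> {0, 1}" "j \<in> {0, 1}"
    and f: "f \<in> Vz n" and Lf: "monodromy L n r j f \<in> Vz n"
  shows "ext_z (bold_s n i) (monodromy L n r j f) = monodromy L n r j (ext_z (bold_s n i) f)"
proof
  fix b
  show "ext_z (bold_s n i) (monodromy L n r j f) b = monodromy L n r j (ext_z (bold_s n i) f) b"
  proof (cases "b \<in> words n")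
    case False
    then show ?thesis
      using assms by (simp add: ext_z_bold_s monodromy_nonword)
  next
    case True
    have n: "1 \<le> n" using assms by simp
    have "ext_z (bold_s n i) (monodromy L n r j f) b = braid_op (perm_poly i) [:\<alpha> i:] i (monodromy L n r j f) b"
      using assms True by (simp add: ext_z_bold_s)
    also have "\<dots> = braid_op (perm_poly i) [:\<alpha> i:] i (transfer L r j f) b"
      using monodromy_word[OF _ n assms(4)] by (rule braid_op_cong_words[OF _ True assms(2,3)])
    also have "\<dots> = transfer L r j (braid_op (perm_poly i) [:\<alpha> i:] i f) b"
      by (rule rll.braid_op_transfer[OF assms(1) True assms(2,3,5)])
    also have "\<dots> = transfer L r j (ext_z (bold_s n i) f) b"
      using True ext_z_bold_s[OF assms(2,3) f] by (intro transfer_cong) (simp add: words_def)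
    also have "\<dots> = monodromy L n r j (ext_z (bold_s n i) f) b"
      using monodromy_word[OF True n assms(4)] by simp
    finally show ?thesis .
  qed
qed

section \<open>Polynomials in the spectral parameter over the Laurent ring\<close>

definition Rep_T_poly :: "nat \<Rightarrow> laurent poly set" where
  "Rep_T_poly n = {p. \<forall>m. coeff p m \<in> Rep_T n}"

lemma Rep_T_poly_0: "0 \<in> Rep_T_poly n"
  by (simp add: Rep_T_poly_def Rep_T_0)

lemma Rep_T_poly_1: "1 \<in> Rep_T_poly n"
  by (simp add: Rep_T_poly_def coeff_1 Rep_T_0 Rep_T_1)

lemma Rep_T_poly_add: "p \<in> Rep_T_poly n \<Longrightarrow> q \<in> Rep_T_poly n \<Longrightarrow> p + q \<in> Rep_T_poly n"
  by (simp add: Rep_T_poly_def Rep_T_add)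

lemma Rep_T_poly_minus: "p \<in> Rep_T_poly n \<Longrightarrow> - p \<in> Rep_T_poly n"
  by (simp add: Rep_T_poly_def Rep_T_minus)

lemma Rep_T_poly_mult: "p \<in> Rep_T_poly n \<Longrightarrow> q \<in> Rep_T_poly n \<Longrightarrow> p * q \<in> Rep_T_poly n"
  by (auto simp: Rep_T_poly_def coeff_mult intro!: Rep_T_sum Rep_T_mult)

lemma Rep_T_poly_sum: "(\<And>x. x \<in> A \<Longrightarrow> g x \<in> Rep_T_poly n) \<Longrightarrow> sum g A \<in> Rep_T_poly n"
  by (induction A rule: infinite_finite_induct) (auto intro: Rep_T_poly_0 Rep_T_poly_add)

lemma Rep_T_poly_prod: "(\<And>x. x \<in> A \<Longrightarrow> g x \<in> Rep_T_poly n) \<Longrightarrow> prod g A \<in> Rep_T_poly n"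
  by (induction A rule: infinite_finite_induct) (auto intro: Rep_T_poly_1 Rep_T_poly_mult)

lemma Rep_T_poly_monomial: "c \<in> Rep_T n \<Longrightarrow> [:0, c:] \<in> Rep_T_poly n"
  by (auto simp: Rep_T_poly_def coeff_pCons Rep_T_0 split: nat.splits)

lemma Rep_T_poly_E: "E a b r c \<in> Rep_T_poly n"
  by (simp add: E_def Rep_T_poly_0 Rep_T_poly_1)

lemmas Rep_T_poly_intros = Rep_T_poly_1 Rep_T_poly_add Rep_T_poly_minus Rep_T_poly_mult
  Rep_T_poly_monomial Rep_T_poly_E

lemma t_mat_in_Rep_T_poly: "u \<in> Rep_T_poly n \<Longrightarrow> t_mat u k j r c \<in> Rep_T_poly n"
  unfolding t_mat_def by (auto intro: Rep_T_poly_intros)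

lemma tt_mat_in_Rep_T_poly: "u \<in> Rep_T_poly n \<Longrightarrow> tt_mat u k j r c \<in> Rep_T_poly n"
  unfolding tt_mat_def by (auto intro: Rep_T_poly_intros)

lemma t_loc_in_Rep_T_poly: "m \<in> {1..n} \<Longrightarrow> t_loc m k j r c \<in> Rep_T_poly n"
  unfolding t_loc_eq_t_mat by (intro t_mat_in_Rep_T_poly Rep_T_poly_monomial eps_inv_in_Rep_T)

lemma tt_loc_in_Rep_T_poly: "m \<in> {1..n} \<Longrightarrow> tt_loc m k j r c \<in> Rep_T_poly n"
  unfolding tt_loc_eq_tt_mat by (intro tt_mat_in_Rep_T_poly Rep_T_poly_monomial eps_in_Rep_T)

lemma Vz_iff: "f \<in> Vz n \<longleftrightarrow> (\<forall>a. f a \<in> Rep_T_poly n) \<and> (\<forall>a. a \<notin> words n \<longrightarrow> f a = 0)"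
  by (simp add: Vz_def Rep_T_poly_def)

lemma monodromy_in_Vz:
  assumes L: "\<And>m k j r c. m \<in> {1..n} \<Longrightarrow> L m k j r c \<in> Rep_T_poly n" and f: "f \<in> Vz n"
  shows "monodromy L n i j f \<in> Vz n"
proof -
  have "f a \<in> Rep_T_poly n" for a
    using f by (simp add: Vz_iff)
  moreover have "L (n - q) k l r c \<in> Rep_T_poly n" if "q < n" for q k l r c
    using that by (intro L) auto
  ultimately have "monodromy L n i j f b \<in> Rep_T_poly n" for b
    unfolding monodromy_def tensor_op_def lin_def
    by (intro Rep_T_poly_sum Rep_T_poly_mult) (auto intro!: Rep_T_poly_prod Rep_T_poly_0)
  then show ?thesis
    by (simp add: Vz_iff monodromy_nonword)
qed

text \<open>The composition rule is transferred to \<open>ext_z\<close> by comparing coefficients,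
  which requires each operator to fix zero and the intermediate vector to lie in
  \<open>Vz\<close>.\<close>

lemma ext_z_R_action_adj:
  assumes "R_action n \<rho>" "1 \<le> i" "i < n" "w permutes {1..n}" "f \<in> Vz n"
  shows "ext_z (\<rho> (adj i \<circ> w)) f = ext_z (bold_s n i) (ext_z (\<rho> w) f)"
proof (rule ext, rule poly_eqI)
  fix b m
  have aw: "adj i \<circ> w permutes {1..n}"
    using assms by (intro permutes_compose[of w] adj_permutes)
  have Vz: "ext_z (\<rho> w) f \<in> Vz n"
    by (intro ext_z_in_Vz[OF assms(5)] R_action_0[OF assms(1,4)] R_action_in_V[OF assms(1,4)])
  have "coeff (ext_z (\<rho> (adj i \<circ> w)) f b) m = \<rho> (adj i \<circ> w) (\<lambda>a. coeff (f a) m) b"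
    by (rule coeff_ext_z[of f n "\<rho> (adj i \<circ> w)", OF assms(5) R_action_0[OF assms(1) aw]])
  also have "\<dots> = bold_s n i (\<rho> w (\<lambda>a. coeff (f a) m)) b"
    by (simp only: R_action_adj[OF assms(1-4) Vz_slice[OF assms(5)]])
  also have "\<rho> w (\<lambda>a. coeff (f a) m) = (\<lambda>a. coeff (ext_z (\<rho> w) f a) m)"
    by (simp only: coeff_ext_z[of f n "\<rho> w", OF assms(5) R_action_0[OF assms(1,4)]])
  also have "bold_s n i \<dots> b = coeff (ext_z (bold_s n i) (ext_z (\<rho> w) f) b) m"
    by (rule coeff_ext_z[of _ n "bold_s n i", OF Vz bold_s_0[OF assms(2,3)], symmetric])
  finally show "coeff (ext_z (\<rho> (adj i \<circ> w)) f b) m = coeff (ext_z (bold_s n i) (ext_z (\<rho> w) f) b) m" .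
qed

lemma ext_z_R_action_id:
  assumes "R_action n \<rho>" "f \<in> Vz n"
  shows "ext_z (\<rho> id) f = f"
proof (rule ext, rule poly_eqI)
  fix b m
  have "coeff (ext_z (\<rho> id) f b) m = \<rho> id (\<lambda>a. coeff (f a) m) b"
    by (rule coeff_ext_z[of f n "\<rho> id", OF assms(2) R_action_0[OF assms(1) permutes_id]])
  then show "coeff (ext_z (\<rho> id) f b) m = coeff (f b) m"
    by (simp only: R_action_id[OF assms(1) Vz_slice[OF assms(2)]])
qed

lemma R_action_monodromy:
  assumes \<rho>: "R_action n \<rho>" and w: "w permutes {1..n}" and f: "f \<in> Vz n"
    and ij: "i \<in> {0, 1}" "j \<in> {0, 1}"
    and rll: "\<And>k. rll (perm_poly k) [:\<alpha> k:] k L"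
    and L: "\<And>m k j r c. m \<in> {1..n} \<Longrightarrow> L m k j r c \<in> Rep_T_poly n"
  shows "ext_z (\<rho> w) (monodromy L n i j f) = monodromy L n i j (ext_z (\<rho> w) f)"
proof -
  note T = monodromy_in_Vz[of n L, OF L]
  define P where "P w \<longleftrightarrow> ext_z (\<rho> w) (monodromy L n i j f) = monodromy L n i j (ext_z (\<rho> w) f)" for w
  have "P w"
    using w
  proof (rule permutes_adj_induct)
    show "P id"
      using ext_z_R_action_id[OF \<rho> f] ext_z_R_action_id[OF \<rho> T[OF _ f]] by (simp only: P_def)
  next
    fix k v assume k: "1 \<le> k" "k < n" and v: "v permutes {1..n}" and IH: "P v"
    have Vz: "ext_z (\<rho> v) f \<in> Vz n"
      by (intro ext_z_in_Vz[OF f] R_action_0[OF \<rho> v] R_action_in_V[OF \<rho> v])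
    have "ext_z (\<rho> (adj k \<circ> v)) (monodromy L n i j f) = ext_z (bold_s n k) (monodromy L n i j (ext_z (\<rho> v) f))"
      using ext_z_R_action_adj[OF \<rho> k v T[OF _ f]] IH by (simp only: P_def)
    also have "\<dots> = monodromy L n i j (ext_z (bold_s n k) (ext_z (\<rho> v) f))"
      by (rule rll_monodromy[OF rll k ij Vz T[OF _ Vz]])
    also have "\<dots> = monodromy L n i j (ext_z (\<rho> (adj k \<circ> v)) f)"
      by (simp only: ext_z_R_action_adj[OF \<rho> k v f])
    finally show "P (adj k \<circ> v)"
      by (simp only: P_def)
  qed
  then show ?thesis by (simp only: P_def)
qed

theorem proposition9p2:
  fixes n :: nat
  assumes "n \<ge> 2"
  shows
    "(\<exists>\<rho>. R_action n \<rho>) \<and>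
     (\<forall>i \<in> {1..<n}. \<forall>\<chi> \<in> Rep_T n. \<forall>J \<in> words n.
        let \<chi>' = perm_laurent (Transposition.transpose i (Suc i)) \<chi>;
            J' = J[i - 1 := J ! i, i := J ! (i - 1)]
        in bold_s n i (pure \<chi> J) =
             (if J ! (i - 1) > J ! i
              then (\<lambda>a. pure (\<alpha> i * \<chi>') J a + pure ((1 - \<alpha> i) * \<chi>') J' a)
              else pure \<chi>' J)) \<and>
     (\<forall>\<rho>. R_action n \<rho> \<longrightarrow>
        (\<forall>k \<le> n. \<forall>w \<in> carrier (sym_group n). \<forall>f \<in> Vk k n. \<rho> w f \<in> Vk k n) \<and>
        (\<forall>w \<in> carrier (sym_group n). \<forall>i \<in> {0, 1}. \<forall>j \<in> {0, 1}. \<forall>f \<in> Vz n.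
           ext_z (\<rho> w) (t_op n i j f) = t_op n i j (ext_z (\<rho> w) f) \<and>
           ext_z (\<rho> w) (tt_op n i j f) = tt_op n i j (ext_z (\<rho> w) f)))"
  unfolding Let_def t_op_def tt_op_def
proof (intro conjI ballI allI impI)
  show "\<exists>\<rho>. R_action n \<rho>" by (rule R_action_exists)
next
  fix i \<chi> J assume "i \<in> {1..<n}" "J \<in> words n"
  then show "bold_s n i (pure \<chi> J) =
    (if J ! (i - 1) > J ! i
     then (\<lambda>a. pure (\<alpha> i * perm_laurent (adj i) \<chi>) J a +
       pure ((1 - \<alpha> i) * perm_laurent (adj i) \<chi>) (J[i - 1 := J ! i, i := J ! (i - 1)]) a)
     else pure (perm_laurent (adj i) \<chi>) J)"
    by (rule bold_s_pure)
next
  fix \<rho> k w f assume "R_action n \<rho>" "w \<in> carrier (sym_group n)" "f \<in> Vk k n"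
  then show "\<rho> w f \<in> Vk k n"
    unfolding sym_group_carrier by (rule R_action_Vk)
next
  fix \<rho> w f and i j :: nat
  assume *: "R_action n \<rho>" "w \<in> carrier (sym_group n)" "i \<in> {0, 1}" "j \<in> {0, 1}" "f \<in> Vz n"
  note comm = R_action_monodromy[OF *(1) *(2)[unfolded sym_group_carrier] *(5) *(3,4)]
  show "ext_z (\<rho> w) (monodromy t_loc n i j f) = monodromy t_loc n i j (ext_z (\<rho> w) f)"
    by (rule comm[OF rll_t_loc t_loc_in_Rep_T_poly])
  show "ext_z (\<rho> w) (monodromy tt_loc n i j f) = monodromy tt_loc n i j (ext_z (\<rho> w) f)"
    by (rule comm[OF rll_tt_loc tt_loc_in_Rep_T_poly])
qed

end
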